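(* Let $\tau:A\to A^+$ be a one-to-one primitive substitution of constant length $p\ge 2$ such that $X_\tau$ is not finite. Then the set of ($T\times T$-)orbits of Li–Yorke pairs of $X_\tau$ is either finite or uncountable. Moreover, the set of Li–Yorke pairs is uncountable if and only if there exist $m\in\mathbb N$ and $a,b\in A$, $a\ne b$, such that $\tau^m(a)=uavaw$ and $\tau^m(b)=u'bv'bw'$ for some (possibly empty) words with $|u|=|u'|$, $|v|=|v'|$, $|w|=|w'|$, and such that $vaw$ and $v'bw'$ have a coincidence.
   Context: $\mathbb N$ is the set of non-negative integers. A substitution is a map $\tau:A\to A^+$, where $A$ is a finite set and $A^+$ is the set of non-empty finite words over $A$; it is extended to $A^+$ by concatenation. It has constant length $p$ if $|\tau(a)|=p$ for all $a\in A$, is one-to-one if $\tau(a)\neq\tau(b)$ for $a\ne b$ in $A$, and is primitive if there is $n$ such that $a$ appears in $\tau^n(b)$ for all $a,b\in A$. The shift is $T((x_i)_i)=(x_{i+1})_i$. $X_\tau$ is the smallest subshift (closed shift-invariant subset) of $A^{\mathbb Z}$ in which all words $\tau^n(a)$, $n\in\mathbb N$, $a\in A$, appear; fix a metric $\varrho$ compatible with its topology. A pair $\{x,y\}$ is a Li–Yorke pair if $\limsup_{n\to\infty}\varrho(T^nx,T^ny)>0$ and $\liminf_{n\to\infty}\varrho(T^nx,T^ny)=0$; the orbit of the pair is $\{(T^nx,T^ny):n\in\mathbb Z\}$. Two words of the same length have a coincidence if they agree in at least one coordinate. *)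

theory Defs
  imports "HOL-Analysis.Analysis"
begin

text \<open>The alphabet is a finite type \<open>'a\<close>; words are lists and points of the full shift are
  functions \<open>int \<Rightarrow> 'a\<close>.\<close>

definition substitution :: "('a \<Rightarrow> 'a list) \<Rightarrow> bool" where
  "substitution \<tau> \<longleftrightarrow> (\<forall>a. \<tau> a \<noteq> [])"

definition subst_word :: "('a \<Rightarrow> 'a list) \<Rightarrow> 'a list \<Rightarrow> 'a list" where
  "subst_word \<tau> w = concat (map \<tau> w)"

definition subst_pow :: "('a \<Rightarrow> 'a list) \<Rightarrow> nat \<Rightarrow> 'a \<Rightarrow> 'a list" where
  "subst_pow \<tau> n a = (subst_word \<tau> ^^ n) [a]"

definition constant_length :: "('a \<Rightarrow> 'a list) \<Rightarrow> nat \<Rightarrow> bool" where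
  "constant_length \<tau> p \<longleftrightarrow> (\<forall>a. length (\<tau> a) = p)"

definition primitive_subst :: "('a \<Rightarrow> 'a list) \<Rightarrow> bool" where
  "primitive_subst \<tau> \<longleftrightarrow> (\<exists>n. \<forall>a b. a \<in> set (subst_pow \<tau> n b))"

definition shift :: "(int \<Rightarrow> 'a) \<Rightarrow> int \<Rightarrow> 'a" where
  "shift x = (\<lambda>i. x (i + 1))"

text \<open>The \<open>n\<close>-th iterate of the shift for integer \<open>n\<close>; the two lemmas characterise it as such.\<close>

definition shift_iter :: "int \<Rightarrow> (int \<Rightarrow> 'a) \<Rightarrow> int \<Rightarrow> 'a" where
  "shift_iter n x = (\<lambda>i. x (i + n))"

lemma shift_iter_nat: "shift_iter (int n) = shift ^^ n"
  by (induction n) (auto simp: shift_iter_def shift_def fun_eq_iff algebra_simps)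

lemma shift_iter_add: "shift_iter (m + n) = shift_iter m \<circ> shift_iter n"
  by (auto simp: shift_iter_def fun_eq_iff algebra_simps)

definition full_shift_topology :: "(int \<Rightarrow> 'a) topology" where
  "full_shift_topology = product_topology (\<lambda>_. discrete_topology UNIV) UNIV"

text \<open>Since the shift is invertible, invariance of a subset means equality with its image.\<close>

definition subshift :: "(int \<Rightarrow> 'a) set \<Rightarrow> bool" where
  "subshift X \<longleftrightarrow> closedin full_shift_topology X \<and> shift ` X = X"

definition appears_in :: "'a list \<Rightarrow> (int \<Rightarrow> 'a) set \<Rightarrow> bool" where
  "appears_in w X \<longleftrightarrow> (\<exists>x\<in>X. \<exists>i. \<forall>j<length w. x (i + int j) = w ! j)"

text \<open>The smallest subshift in which all the words \<open>subst_pow \<tau> n a\<close> appear, written as the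
  intersection of all of them. For a primitive \<open>\<tau>\<close> of constant length at least 2 this
  intersection is itself such a subshift, namely the set of points all of whose finite factors
  occur in some \<open>subst_pow \<tau> n a\<close>.\<close>

definition subst_shift :: "('a \<Rightarrow> 'a list) \<Rightarrow> (int \<Rightarrow> 'a) set" where
  "subst_shift \<tau> = \<Inter> {X. subshift X \<and> (\<forall>n a. appears_in (subst_pow \<tau> n a) X)}"

text \<open>Compatible metrics are metrics on the subshift itself, not on the full shift.\<close>

definition compatible_metric ::
    "(int \<Rightarrow> 'a) set \<Rightarrow> ((int \<Rightarrow> 'a) \<Rightarrow> (int \<Rightarrow> 'a) \<Rightarrow> real) \<Rightarrow> bool" where
  "compatible_metric X d \<longleftrightarrow>
     Metric_space X d \<and> Metric_space.mtopology X d = subtopology full_shift_topology X"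

definition li_yorke ::
    "((int \<Rightarrow> 'a) \<Rightarrow> (int \<Rightarrow> 'a) \<Rightarrow> real) \<Rightarrow> (int \<Rightarrow> 'a) \<Rightarrow> (int \<Rightarrow> 'a) \<Rightarrow> bool" where
  "li_yorke d x y \<longleftrightarrow>
     limsup (\<lambda>n. ereal (d ((shift ^^ n) x) ((shift ^^ n) y))) > 0 \<and>
     liminf (\<lambda>n. ereal (d ((shift ^^ n) x) ((shift ^^ n) y))) = 0"

definition li_yorke_pairs ::
    "(int \<Rightarrow> 'a) set \<Rightarrow> ((int \<Rightarrow> 'a) \<Rightarrow> (int \<Rightarrow> 'a) \<Rightarrow> real) \<Rightarrow> (int \<Rightarrow> 'a) set set" where
  "li_yorke_pairs X d = {{x, y} | x y. x \<in> X \<and> y \<in> X \<and> li_yorke d x y}"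

definition pair_orbit :: "(int \<Rightarrow> 'a) \<Rightarrow> (int \<Rightarrow> 'a) \<Rightarrow> ((int \<Rightarrow> 'a) \<times> (int \<Rightarrow> 'a)) set" where
  "pair_orbit x y = {(shift_iter n x, shift_iter n y) | n. True}"

text \<open>An unordered pair contributes the orbits of both of its orderings; this affects neither
  finiteness nor countability.\<close>

definition li_yorke_orbits ::
    "(int \<Rightarrow> 'a) set \<Rightarrow> ((int \<Rightarrow> 'a) \<Rightarrow> (int \<Rightarrow> 'a) \<Rightarrow> real)
      \<Rightarrow> ((int \<Rightarrow> 'a) \<times> (int \<Rightarrow> 'a)) set set" where
  "li_yorke_orbits X d = {pair_orbit x y | x y. {x, y} \<in> li_yorke_pairs X d}"

definition has_coincidence :: "'a list \<Rightarrow> 'a list \<Rightarrow> bool" where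
  "has_coincidence s t \<longleftrightarrow> length s = length t \<and> (\<exists>i<length s. s ! i = t ! i)"

end

theory Submission
  imports Defs "HOL-Library.Diagonal_Subsequence"
begin

text \<open>Write \<open>q = p ^ n\<close>. Each point of the subshift is cut into blocks
  \<open>\<tau>\<^sup>n(c)\<close> of length \<open>q\<close>, at some offset below \<open>q\<close>
  (\<open>admissible_desubstitute\<close>), and the offset is unique (\<open>recognizability\<close>): by minimality a second
  offset would make one of the \<open>q\<close> offsets superfluous for producing words, so that multiplying the
  length by about \<open>q\<close> would multiply the number of words by at most \<open>q - 1\<close>. The number of words would
  then grow sublinearly, whereas an infinite subshift has at least \<open>n\<close> words of length \<open>n\<close>.

  By compactness, being a Li--Yorke pair only depends on coordinates (\<open>li_yorke_iff\<close>): the points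
  disagree infinitely often to the right and agree on arbitrarily long windows arbitrarily far to the
  right. The condition on words says that the pair \<open>(a, b)\<close> occurs at two positions \<open>s < t\<close> of the pair of
  blocks \<open>(\<tau>\<^sup>m(a), \<tau>\<^sup>m(b))\<close> and that these blocks agree at some position to the right
  of \<open>s\<close>.

  If it holds, choose for every level one of the digits \<open>s\<close> and \<open>t\<close> and place the pair of blocks of each level
  inside the pair of the next level at the position given by the digit. The union is a pair of points.
  A level with digit \<open>s\<close> produces a disagreement and a long agreement to the right, so digit
  sequences in which both digits recur give Li--Yorke pairs. By recognizability the
  points determine the digits, hence there are uncountably many pairs
  (\<open>uncountable_li_yorke_pairs\<close>).

  If it fails, let two Li--Yorke pairs be given. Points that agree on long windows have the same offset
  (a limit of the windows is parsed in both ways), so both members of a pair are desubstituted in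
  parallel, for ever. Suppose that the two pairs show the same letters around the origin on infinitely
  many levels. Between two such levels, the pair of letters \<open>a \<noteq> b\<close> at the origin reappears
  inside its own pair of blocks, with an agreement to its right; since it cannot do so at two
  positions, the two pairs have the same offsets from some level on, and therefore the same orbit. The letters
  around the origin are thus a colouring of the orbits by finitely many colours on every level,
  which separates the orbits in the sense of \<open>finite_if_colourings_separate\<close>, and there are only finitely
  many orbits. The argument needs that the blocks around the origin exhaust the line; when they do not,
  the offsets are eventually all \<open>0\<close> or all \<open>p - 1\<close> and agree for that reason.\<close>

section \<open>Compactness of the full shift\<close>

lemma pointwise_convergent_subsequence:
  fixes f :: "nat \<Rightarrow> int \<Rightarrow> 'a::finite"
  obtains r :: "nat \<Rightarrow> nat" and z where "strict_mono r" and "\<And>M. \<exists>K. \<forall>k\<ge>K. \<forall>l. \<bar>l\<bar> \<le> M \<longrightarrow> f (r k) l = z l"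
proof -
  define Q where "Q n s \<longleftrightarrow> (\<exists>c. \<exists>K. \<forall>k\<ge>K. f (s k) (from_nat n) = c)" for n and s :: "nat \<Rightarrow> nat"
  interpret subseqs Q
  proof
    fix n and s :: "nat \<Rightarrow> nat" assume "strict_mono s"
    have "\<exists>c\<in>UNIV. infinite {k \<in> UNIV. f (s k) (from_nat n) = c}"
      by (rule pigeonhole_infinite_rel) auto
    then obtain c where c: "infinite {k. f (s k) (from_nat n) = c}" by auto
    then obtain r :: "nat \<Rightarrow> nat" where "strict_mono r" "\<And>k. r k \<in> {k. f (s k) (from_nat n) = c}"
      using infinite_enumerate by blast
    then show "\<exists>r'. strict_mono r' \<and> Q n (s \<circ> r')" by (auto simp: Q_def)
  qed
  have Q: "Q n diagseq" for n
  proof -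
    have "Q n (diagseq \<circ> (+) (Suc n))"
    proof (rule diagseq_holds)
      fix r s :: "nat \<Rightarrow> nat" and n assume "strict_mono r" "Q n s"
      then show "Q n (s \<circ> r)"
        unfolding Q_def o_def by (meson le_trans seq_suble)
    qed
    then obtain c K where "\<And>k. k \<ge> K \<Longrightarrow> f (diagseq (Suc n + k)) (from_nat n) = c"
      by (auto simp: Q_def)
    then have "f (diagseq k) (from_nat n) = c" if "k \<ge> Suc n + K" for k
      using that by (metis Nat.le_diff_conv2 add.commute le_add1 le_add_diff_inverse le_trans)
    then show ?thesis unfolding Q_def by blast
  qed
  have "\<exists>c K. \<forall>k\<ge>K. f (diagseq k) l = c" for l
    using Q[of "to_nat l"] unfolding Q_def from_nat_to_nat .
  then have "\<forall>l. \<exists>c K. \<forall>k\<ge>K. f (diagseq k) l = c" by blast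
  then obtain z where "\<forall>l. \<exists>K. \<forall>k\<ge>K. f (diagseq k) l = z l"
    unfolding choice_iff by blast
  then obtain B where zB: "\<And>l k. k \<ge> B l \<Longrightarrow> f (diagseq k) l = z l"
    unfolding choice_iff by blast
  have "\<exists>K. \<forall>k\<ge>K. \<forall>l. \<bar>l\<bar> \<le> M \<longrightarrow> f (diagseq k) l = z l" for M
  proof (intro exI allI impI)
    fix k l assume k: "k \<ge> Max (insert 0 (B ` {-M..M}))" and l: "\<bar>l\<bar> \<le> M"
    have "B l \<le> Max (insert 0 (B ` {-M..M}))" using l by (intro Max_ge insertI2 imageI) auto
    then have "B l \<le> k" using k by (rule order_trans)
    then show "f (diagseq k) l = z l" by (rule zB)
  qed
  then show ?thesis using that[OF subseq_diagseq] by blast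
qed

section \<open>Iterated blocks of a substitution of constant length\<close>

lemma nth_concat_map_uniform:
  assumes "\<And>c. c \<in> set w \<Longrightarrow> length (f c) = k" and "j < k * length w"
  shows "concat (map f w) ! j = f (w ! (j div k)) ! (j mod k)"
  using assms
proof (induction w arbitrary: j)
  case (Cons c w)
  have k: "k > 0" using Cons.prems by (cases k) auto
  show ?case
  proof (cases "j < k")
    case True
    then show ?thesis using Cons.prems by (simp add: nth_append)
  next
    case False
    then have "concat (map f (c # w)) ! j = concat (map f w) ! (j - k)"
      using Cons.prems by (simp add: nth_append)
    also have "\<dots> = f (w ! ((j - k) div k)) ! ((j - k) mod k)"
      using Cons.prems False by (intro Cons.IH) (auto simp: algebra_simps)
    finally show ?thesis using False k
      by (simp add: le_div_geq le_mod_geq not_less)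
  qed
qed simp

lemma subst_word_power_eq: "(subst_word \<tau> ^^ n) w = concat (map (subst_pow \<tau> n) w)"
proof (induction n arbitrary: w)
  case 0
  show ?case by (induction w) (auto simp: subst_pow_def)
next
  case (Suc n)
  have app: "subst_word \<tau> (concat ws) = concat (map (subst_word \<tau>) ws)" for ws
    by (induction ws) (auto simp: subst_word_def)
  have "subst_pow \<tau> (Suc n) = subst_word \<tau> \<circ> subst_pow \<tau> n"
    by (auto simp: subst_pow_def fun_eq_iff)
  then show ?case by (simp add: Suc app comp_def)
qed

locale constant_length_subst =
  fixes \<tau> :: "'a::finite \<Rightarrow> 'a list" and p :: nat
  assumes const_len: "constant_length \<tau> p" and p_ge_2: "p \<ge> 2"
begin

abbreviation P :: int where "P \<equiv> int p"

text \<open>Letters of iterated blocks, indexed by integers so that positions can be split with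
  \<open>div\<close> and \<open>mod\<close> on either side of the origin.\<close>

definition blk :: "nat \<Rightarrow> 'a \<Rightarrow> int \<Rightarrow> 'a" where
  "blk n a j = subst_pow \<tau> n a ! nat j"

definition inflate :: "nat \<Rightarrow> (int \<Rightarrow> 'a) \<Rightarrow> int \<Rightarrow> 'a" where
  "inflate n x = (\<lambda>l. blk n (x (l div P ^ n)) (l mod P ^ n))"

lemma p_pos [simp]: "p > 0"
  using p_ge_2 by simp

lemma P_power_pos [simp]: "P ^ n > 0"
  using p_ge_2 by simp

lemma P_power_ge: "int n < P ^ n"
  using p_ge_2 by (metis of_nat_less_iff of_nat_power power_gt_expt less_eq_Suc_le numeral_2_eq_2)

lemma P_power_le: "m \<le> n \<Longrightarrow> P ^ m \<le> P ^ n"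
  using p_ge_2 by (intro power_increasing) auto

lemma P_power_less_D: "P ^ m < P ^ n \<Longrightarrow> m < n"
  using P_power_le[of n m] by (metis leD leI)

lemma length_subst_pow: "length (subst_pow \<tau> n a) = p ^ n"
proof (induction n)
  case (Suc n)
  have "length (subst_word \<tau> w) = p * length w" for w
    using const_len by (induction w) (auto simp: subst_word_def constant_length_def)
  then show ?case using Suc by (simp add: subst_pow_def)
qed (simp add: subst_pow_def)

lemma blk_0 [simp]: "blk 0 a 0 = a"
  by (simp add: blk_def subst_pow_def)

lemma blk_add:
  assumes "0 \<le> j" "j < P ^ (n + m)"
  shows "blk (n + m) a j = blk n (blk m a (j div P ^ n)) (j mod P ^ n)"
proof -
  have "subst_pow \<tau> (n + m) a = concat (map (subst_pow \<tau> n) (subst_pow \<tau> m a))"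
    using subst_word_power_eq[of n \<tau> "subst_pow \<tau> m a"] by (simp add: subst_pow_def funpow_add)
  moreover have "nat j < p ^ n * p ^ m"
    using assms by (metis nat_less_iff of_nat_power power_add)
  ultimately show ?thesis using assms
    by (simp add: blk_def nth_concat_map_uniform length_subst_pow nat_div_distrib nat_mod_distrib
         nat_power_eq)
qed

lemma blk_add_mult:
  assumes "0 \<le> q" "q < P ^ n" "0 \<le> s" "s < P ^ m"
  shows "s * P ^ n + q < P ^ (n + m)" "blk (n + m) a (s * P ^ n + q) = blk n (blk m a s) q"
proof -
  have "(s + 1) * P ^ n \<le> P ^ m * P ^ n" using assms by (intro mult_right_mono) auto
  then show *: "s * P ^ n + q < P ^ (n + m)" using assms by (simp add: power_add algebra_simps)
  show "blk (n + m) a (s * P ^ n + q) = blk n (blk m a s) q"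
    using assms * by (subst blk_add) (auto simp: )
qed

lemma inflate_0 [simp]: "inflate 0 x = x"
  by (simp add: inflate_def)

lemma inflate_shift: "inflate n (shift_iter k x) = shift_iter (k * P ^ n) (inflate n x)"
  using P_power_pos[of n] by (simp add: inflate_def shift_iter_def fun_eq_iff add.commute)

lemma inflate_add: "inflate (n + m) x = inflate n (inflate m x)"
proof
  fix l
  have 1: "l div P ^ (n + m) = l div P ^ n div P ^ m"
    by (simp add: power_add zdiv_zmult2_eq)
  have 2: "l mod P ^ (n + m) = (l div P ^ n mod P ^ m) * P ^ n + l mod P ^ n"
    by (simp add: power_add zmod_zmult2_eq)
  show "inflate (n + m) x l = inflate n (inflate m x) l"
    unfolding inflate_def 1 2 by (subst blk_add_mult) auto
qed

section \<open>The subshift as the set of points with admissible windows\<close>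

text \<open>Windows centred at the origin suffice to express that all factors of \<open>x\<close> occur in blocks: every
  finite set of coordinates lies in one of them.\<close>

definition admissible :: "(int \<Rightarrow> 'a) set" where
  "admissible = {x. \<forall>N. \<exists>n a j. N \<le> j \<and> j + N < P ^ n \<and> (\<forall>l. \<bar>l\<bar> \<le> N \<longrightarrow> x l = blk n a (j + l))}"

lemma admissible_window:
  assumes "x \<in> admissible"
  obtains n a j where "N \<le> j" "j + N < P ^ n" "\<And>l. \<bar>l\<bar> \<le> N \<Longrightarrow> x l = blk n a (j + l)"
  using assms unfolding admissible_def by blast

lemma admissibleI:
  assumes "\<And>N. N \<ge> B \<Longrightarrow> \<exists>n a j. N \<le> j \<and> j + N < P ^ n \<and> (\<forall>l. \<bar>l\<bar> \<le> N \<longrightarrow> x l = blk n a (j + l))"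
  shows "x \<in> admissible"
  unfolding admissible_def
proof (intro CollectI allI)
  fix N
  obtain n a j where "max B N \<le> j" "j + max B N < P ^ n"
      "\<forall>l. \<bar>l\<bar> \<le> max B N \<longrightarrow> x l = blk n a (j + l)"
    using assms[of "max B N"] by auto
  then show "\<exists>n a j. N \<le> j \<and> j + N < P ^ n \<and> (\<forall>l. \<bar>l\<bar> \<le> N \<longrightarrow> x l = blk n a (j + l))"
    by (intro exI[of _ n] exI[of _ a] exI[of _ j]) auto
qed

lemma admissible_closed:
  assumes "\<And>M. \<exists>y\<in>admissible. \<forall>l. \<bar>l\<bar> \<le> M \<longrightarrow> x l = y l"
  shows "x \<in> admissible"
proof (rule admissibleI)
  fix N :: int
  obtain y where y: "y \<in> admissible" "\<forall>l. \<bar>l\<bar> \<le> N \<longrightarrow> x l = y l" using assms by blast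
  obtain n a j
    where "N \<le> j" "j + N < P ^ n" "\<And>l. \<bar>l\<bar> \<le> N \<Longrightarrow> y l = blk n a (j + l)"
      by (rule admissible_window[OF y(1), of N]) blast
  then show "\<exists>n a j. N \<le> j \<and> j + N < P ^ n \<and> (\<forall>l. \<bar>l\<bar> \<le> N \<longrightarrow> x l = blk n a (j + l))"
    using y(2) by metis
qed

lemma admissible_shift:
  assumes "x \<in> admissible"
  shows "shift_iter k x \<in> admissible"
proof (rule admissibleI[of 0])
  fix N :: int assume "N \<ge> 0"
  obtain n a j
    where *: "N + \<bar>k\<bar> \<le> j" "j + (N + \<bar>k\<bar>) < P ^ n" "\<And>l. \<bar>l\<bar> \<le> N + \<bar>k\<bar> \<Longrightarrow> x l = blk n a (j + l)"
      by (rule admissible_window[OF assms, of "N + \<bar>k\<bar>"]) blast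
  show "\<exists>n a j. N \<le> j \<and> j + N < P ^ n \<and> (\<forall>l. \<bar>l\<bar> \<le> N \<longrightarrow> shift_iter k x l = blk n a (j + l))"
  proof (intro exI conjI allI impI)
    show "N \<le> j + k" "j + k + N < P ^ n" using * by auto
    fix l assume "\<bar>l\<bar> \<le> N"
    then show "shift_iter k x l = blk n a (j + k + l)"
      using *(3)[of "l + k"] by (simp add: shift_iter_def algebra_simps)
  qed
qed

text \<open>The parsing of a point into blocks of level \<open>n\<close> is inherited by compactness from the
  parsing of its finite windows.\<close>

lemma admissible_desubstitute:
  assumes "x \<in> admissible"
  obtains i x' where "0 \<le> i" "i < P ^ n" "x' \<in> admissible" "x = shift_iter i (inflate n x')"
proof -
  \<comment> \<open>The window is taken larger by one block, which forces the level of the surrounding block to exceed \<open>n\<close>.\<close>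
  have "\<exists>y i. (0 \<le> i \<and> i < P ^ n) \<and> (\<forall>l. \<bar>l\<bar> \<le> int N \<longrightarrow> x l = shift_iter i (inflate n y) l) \<and>
     (\<exists>m a s. int N div P ^ n \<le> s \<and> s + int N div P ^ n < P ^ m
         \<and> (\<forall>r. \<bar>r\<bar> \<le> int N div P ^ n \<longrightarrow> y r = blk m a (s + r)))" for N
  proof -
    obtain m' a j
      where *: "int N + P ^ n \<le> j" "j + (int N + P ^ n) < P ^ m'"
        "\<And>l. \<bar>l\<bar> \<le> int N + P ^ n \<Longrightarrow> x l = blk m' a (j + l)"
      by (rule admissible_window[OF assms, of "int N + P ^ n"]) blast
    have Ppos: "P ^ n > 0" by (rule P_power_pos)
    have jN: "int N \<le> j" "j + int N < P ^ m'" using * Ppos by linarith+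
    have "n < m'" using * Ppos by (intro P_power_less_D) linarith
    then obtain m where m': "m' = n + m" using le_Suc_ex less_imp_le by blast
    define s where "s = j div P ^ n"
    define i where "i = j mod P ^ n"
    define y where "y = (\<lambda>r. blk m a (s + r))"
    have j: "j = s * P ^ n + i" by (simp only: s_def i_def div_mult_mod_eq)
    have 1: "0 \<le> i \<and> i < P ^ n" by (simp add: i_def)
    have 2: "x l = shift_iter i (inflate n y) l" if "\<bar>l\<bar> \<le> int N" for l
    proof -
      have lN: "\<bar>l\<bar> \<le> int N + P ^ n" using that Ppos by linarith
      then have "x l = blk (n + m) a (j + l)" using *(3) m' by simp
      also have "\<dots> = blk n (blk m a ((j + l) div P ^ n)) ((j + l) mod P ^ n)"
        by (rule blk_add) (use * lN m' in auto)
      also have "j + l = s * P ^ n + (l + i)" using j by simp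
      also have "(s * P ^ n + (l + i)) div P ^ n = s + (l + i) div P ^ n"
        using Ppos by (intro div_mult_self3) auto
      also have "(s * P ^ n + (l + i)) mod P ^ n = (l + i) mod P ^ n" by simp
      finally show ?thesis by (simp add: shift_iter_def inflate_def y_def)
    qed
    have 3: "int N div P ^ n \<le> s" unfolding s_def using jN by (intro zdiv_mono1) auto
    have "(s + int N div P ^ n) * P ^ n \<le> j + N"
    proof -
      have "s * P ^ n \<le> j" using j 1 by linarith
      moreover have "int N div P ^ n * P ^ n \<le> int N"
        using div_mult_mod_eq[of "int N" "P ^ n"] Ppos
        by (metis Euclidean_Rings.pos_mod_sign add_increasing2 order_refl)
      ultimately show ?thesis by (simp add: distrib_right)
    qed
    then have "(s + int N div P ^ n) * P ^ n < P ^ m * P ^ n"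
      using jN m' by (simp only: power_add mult.commute[of "P ^ n"])
    then have 4: "s + int N div P ^ n < P ^ m" using Ppos mult_right_less_imp_less by (metis less_imp_le)
    show ?thesis using 1 2 3 4 unfolding y_def by blast
  qed
  then obtain y i where
    i: "\<And>N. 0 \<le> i N \<and> i N < P ^ n" and
    xy: "\<And>N l. \<bar>l\<bar> \<le> int N \<Longrightarrow> x l = shift_iter (i N) (inflate n (y N)) l" and
    ad: "\<And>N. \<exists>m a s. int N div P ^ n \<le> s \<and> s + int N div P ^ n < P ^ m
         \<and> (\<forall>r. \<bar>r\<bar> \<le> int N div P ^ n \<longrightarrow> y N r = blk m a (s + r))"
    by metis
  have "\<exists>i0\<in>{0..<P ^ n}. infinite {N \<in> UNIV. i N = i0}"
    using i by (intro pigeonhole_infinite_rel) auto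
  then obtain i0 where i0: "0 \<le> i0" "i0 < P ^ n" and inf: "infinite {N. i N = i0}" by (auto simp del: of_nat_power)
  obtain s :: "nat \<Rightarrow> nat" where s: "strict_mono s" "\<And>k. i (s k) = i0"
    using infinite_enumerate[OF inf] by auto
  obtain r :: "nat \<Rightarrow> nat" and z where r: "strict_mono r" and z: "\<And>M. \<exists>K. \<forall>k\<ge>K. \<forall>l. \<bar>l\<bar> \<le> M \<longrightarrow> y (s (r k)) l = z l"
    using pointwise_convergent_subsequence[of "\<lambda>k. y (s k)"] by blast
  have large: "\<exists>k. (\<forall>l. \<bar>l\<bar> \<le> M \<longrightarrow> y (s (r k)) l = z l) \<and> int (s (r k)) \<ge> M'" for M M'
  proof -
    obtain K where K: "\<forall>k\<ge>K. \<forall>l. \<bar>l\<bar> \<le> M \<longrightarrow> y (s (r k)) l = z l" using z by blast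
    have "s (r k) \<ge> k" for k :: nat using s(1) r seq_suble le_trans by blast
    then have "s (r (max K (nat M'))) \<ge> max K (nat M')" by blast
    then have "int (s (r (max K (nat M')))) \<ge> M'" by linarith
    then show ?thesis using K max.cobounded1 by blast
  qed
  have "z \<in> admissible"
  proof (rule admissibleI[of 0])
    fix N :: int assume N: "N \<ge> 0"
    obtain k where k: "\<forall>l. \<bar>l\<bar> \<le> N \<longrightarrow> y (s (r k)) l = z l" "int (s (r k)) \<ge> N * P ^ n"
      using large by blast
    have "N = N * P ^ n div P ^ n" using P_power_pos[of n] by simp
    also have "\<dots> \<le> int (s (r k)) div P ^ n" using k P_power_pos[of n] by (intro zdiv_mono1) auto
    finally show "\<exists>n a j. N \<le> j \<and> j + N < P ^ n \<and> (\<forall>l. \<bar>l\<bar> \<le> N \<longrightarrow> z l = blk n a (j + l))"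
      using ad[of "s (r k)"] k(1) by (smt (verit, best))
  qed
  moreover have "x = shift_iter i0 (inflate n z)"
  proof
    fix l
    obtain k where k: "\<forall>l'. \<bar>l'\<bar> \<le> \<bar>(l + i0) div P ^ n\<bar> \<longrightarrow> y (s (r k)) l' = z l'" "int (s (r k)) \<ge> \<bar>l\<bar>"
      using large by blast
    show "x l = shift_iter i0 (inflate n z) l"
      using xy[OF k(2)] k(1) s(2) by (simp add: shift_iter_def inflate_def)
  qed
  ultimately show ?thesis using that i0 by blast
qed

end

section \<open>Topology of the full shift\<close>

lemma full_shift_openD:
  assumes "openin full_shift_topology U" "x \<in> U"
  obtains M where "\<And>y. (\<And>l. \<bar>l\<bar> \<le> M \<Longrightarrow> y l = x l) \<Longrightarrow> y \<in> U"
proof -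
  obtain V where V: "finite {i. V i \<noteq> UNIV}" "x \<in> PiE UNIV V" "PiE UNIV V \<subseteq> U"
    using assms unfolding full_shift_topology_def openin_product_topology_alt by auto
  define M where "M = Max (insert 0 (abs ` {i. V i \<noteq> UNIV}))"
  show ?thesis
  proof (rule that[of M])
    fix y assume y: "\<And>l. \<bar>l\<bar> \<le> M \<Longrightarrow> y l = x l"
    have "y l \<in> V l" for l
    proof (cases "V l = UNIV")
      case False
      then have "\<bar>l\<bar> \<le> M" unfolding M_def using V(1) by (intro Max_ge insertI2 imageI) auto
      then show ?thesis using y V(2) by auto
    qed simp
    then show "y \<in> U" using V(3) by auto
  qed
qed

lemma openin_full_shift_cylinder: "openin full_shift_topology {y. \<forall>l. \<bar>l\<bar> \<le> M \<longrightarrow> y l = x l}"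
  unfolding full_shift_topology_def openin_product_topology_alt
proof (intro ballI conjI subsetI)
  fix y assume "y \<in> {y. \<forall>l. \<bar>l\<bar> \<le> M \<longrightarrow> y l = x l}"
  then have "y \<in> PiE UNIV (\<lambda>l. if \<bar>l\<bar> \<le> M then {x l} else UNIV)"
    "PiE UNIV (\<lambda>l. if \<bar>l\<bar> \<le> M then {x l} else UNIV) \<subseteq> {y. \<forall>l. \<bar>l\<bar> \<le> M \<longrightarrow> y l = x l}"
    by (auto simp: PiE_iff split: if_splits)
  moreover have "finite {i. (if \<bar>i\<bar> \<le> M then {x i} else UNIV) \<noteq> UNIV}"
    by (rule finite_subset[of _ "{-M..M}"]) auto
  ultimately show "\<exists>U. finite {i \<in> UNIV. U i \<noteq> topspace (discrete_topology UNIV)} \<and>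
       (\<forall>i\<in>UNIV. openin (discrete_topology UNIV) (U i)) \<and>
       y \<in> PiE UNIV U \<and> PiE UNIV U \<subseteq> {y. \<forall>l. \<bar>l\<bar> \<le> M \<longrightarrow> y l = x l}"
    by (intro exI[of _ "\<lambda>l. if \<bar>l\<bar> \<le> M then {x l} else UNIV"]) auto
qed

lemma topspace_full_shift [simp]: "topspace full_shift_topology = UNIV"
  by (simp add: full_shift_topology_def)

lemma compact_space_full_shift:
  "compact_space (full_shift_topology :: (int \<Rightarrow> 'a::finite) topology)"
  unfolding full_shift_topology_def
  by (simp add: compact_space_product_topology compact_space_discrete_topology)

lemma closedin_full_shift_iff:
  "closedin full_shift_topology Y \<longleftrightarrow>
     (\<forall>x. (\<forall>M. \<exists>y\<in>Y. \<forall>l. \<bar>l\<bar> \<le> M \<longrightarrow> y l = x l) \<longrightarrow> x \<in> Y)" (is "?L \<longleftrightarrow> ?R")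
proof
  assume ?L
  then have op: "openin full_shift_topology (- Y)"
    by (simp add: closedin_def Compl_eq_Diff_UNIV)
  show ?R
  proof (intro allI impI, rule ccontr)
    fix x assume *: "\<forall>M. \<exists>y\<in>Y. \<forall>l. \<bar>l\<bar> \<le> M \<longrightarrow> y l = x l" and "x \<notin> Y"
    then obtain M where "\<And>y. (\<And>l. \<bar>l\<bar> \<le> M \<Longrightarrow> y l = x l) \<Longrightarrow> y \<in> - Y"
      using full_shift_openD[OF op, of x] by blast
    then show False using * by blast
  qed
next
  assume R: ?R
  have "openin full_shift_topology (- Y)"
  proof (subst openin_subopen, intro ballI)
    fix x assume "x \<in> - Y"
    then obtain M where "\<not> (\<exists>y\<in>Y. \<forall>l. \<bar>l\<bar> \<le> M \<longrightarrow> y l = x l)" using R by blast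
    then show "\<exists>T. openin full_shift_topology T \<and> x \<in> T \<and> T \<subseteq> - Y"
      using openin_full_shift_cylinder[of M x] by (intro exI[of _ "{y. \<forall>l. \<bar>l\<bar> \<le> M \<longrightarrow> y l = x l}"]) auto
  qed
  then show ?L by (simp add: closedin_def Compl_eq_Diff_UNIV)
qed

lemma shift_iter_0 [simp]: "shift_iter 0 x = x"
  by (simp add: shift_iter_def)

lemma shift_iter_shift_iter [simp]: "shift_iter m (shift_iter n x) = shift_iter (m + n) x"
  by (simp add: shift_iter_add)

lemma shift_eq_shift_iter: "shift = shift_iter 1"
  by (simp add: shift_def shift_iter_def fun_eq_iff)

lemma subshift_shift_iter:
  assumes "subshift Y" "y \<in> Y"
  shows "shift_iter k y \<in> Y"
proof -
  have inv: "shift_iter 1 ` Y = Y"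
    using assms(1) by (simp add: subshift_def shift_eq_shift_iter)
  have fwd: "shift_iter (int n) y \<in> Y" for n
  proof (induction n)
    case (Suc n)
    then have "shift_iter 1 (shift_iter (int n) y) \<in> Y" using inv by blast
    then show ?case by simp
  qed (use assms in simp)
  have bwd: "shift_iter (- int n) y \<in> Y" for n
  proof (induction n)
    case (Suc n)
    then obtain z where z: "z \<in> Y" "shift_iter (- int n) y = shift_iter 1 z" using inv by blast
    from z(2) have "shift_iter (- 1) (shift_iter (- int n) y) = shift_iter (- 1) (shift_iter 1 z)"
      by (rule arg_cong)
    then have "shift_iter (- int (Suc n)) y = z" by (simp add: algebra_simps)
    then show ?case using z by simp
  qed (use assms in simp)
  show ?thesis using fwd[of "nat k"] bwd[of "nat (- k)"] by (cases "k \<ge> 0") auto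
qed

section \<open>Minimality\<close>

locale primitive_subst_constant_length = constant_length_subst +
  assumes prim: "primitive_subst \<tau>"
begin

lemma primitive_blk:
  obtains n0 where "\<And>a b. \<exists>e. 0 \<le> e \<and> e < P ^ n0 \<and> blk n0 b e = a"
proof -
  obtain n0 where "\<And>a b. a \<in> set (subst_pow \<tau> n0 b)"
    using prim unfolding primitive_subst_def by auto
  then have "\<exists>e. 0 \<le> e \<and> e < P ^ n0 \<and> blk n0 b e = a" for a b
  proof -
    obtain i where "i < p ^ n0" "subst_pow \<tau> n0 b ! i = a"
      using \<open>a \<in> set _\<close> by (metis in_set_conv_nth length_subst_pow)
    then show ?thesis
      by (intro exI[of _ "int i"]) (auto simp: blk_def simp flip: of_nat_power)
  qed
  then show ?thesis using that by blast
qed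

text \<open>Every block contains every given window of a point once its level is large enough, and every
  sufficiently long window of a point contains a full block.\<close>

lemma block_occurs_everywhere:
  assumes "y \<in> admissible"
  shows "\<exists>s. \<forall>q. 0 \<le> q \<and> q < P ^ n \<longrightarrow> y (s + q) = blk n b q"
proof -
  obtain n0 where n0: "\<And>a b. \<exists>e. 0 \<le> e \<and> e < P ^ n0 \<and> blk n0 b e = a"
    using primitive_blk by blast
  define K where "K = n + n0"
  have Kpos: "P ^ K > 0" by (rule P_power_pos)
  obtain m' c j where *: "P ^ K \<le> j" "j + P ^ K < P ^ m'" "\<And>l. \<bar>l\<bar> \<le> P ^ K \<Longrightarrow> y l = blk m' c (j + l)"
    by (rule admissible_window[OF assms, of "P ^ K"]) blast
  have "K < m'" using * Kpos by (intro P_power_less_D) linarith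
  then obtain m where m': "m' = K + m" using le_Suc_ex less_imp_le by blast
  define s where "s = j div P ^ K"
  define i where "i = j mod P ^ K"
  have j: "j = s * P ^ K + i" by (simp only: s_def i_def div_mult_mod_eq)
  have i: "0 \<le> i" "i < P ^ K" by (auto simp: i_def)
  have s: "0 \<le> s" unfolding s_def using *(1) Kpos pos_imp_zdiv_nonneg_iff[OF Kpos, of j] by linarith
  have "s * P ^ K < P ^ m'" using *(1,2) j i Kpos by linarith
  then have "s * P ^ K < P ^ m * P ^ K" by (simp only: m' power_add mult.commute)
  then have sm: "s < P ^ m" using Kpos mult_right_less_imp_less by (metis less_imp_le)
  define c' where "c' = blk m c s"
  have yK: "y (q - i) = blk K c' q" if "0 \<le> q" "q < P ^ K" for q
  proof -
    have "y (q - i) = blk m' c (j + (q - i))" using *(3)[of "q - i"] that i by linarith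
    also have "j + (q - i) = s * P ^ K + q" using j by simp
    finally show ?thesis using blk_add_mult(2)[OF that s sm] m' by (simp add: c'_def)
  qed
  obtain e where e: "0 \<le> e" "e < P ^ n0" "blk n0 c' e = b" using n0 by blast
  have "y (e * P ^ n - i + q) = blk n b q" if q: "0 \<le> q" "q < P ^ n" for q
  proof -
    have eq: "e * P ^ n + q < P ^ K" "blk K c' (e * P ^ n + q) = blk n b q"
      using blk_add_mult[OF q e(1,2)] e(3) by (auto simp: K_def)
    have "0 \<le> e * P ^ n + q" using e q by simp
    from yK[OF this eq(1)] eq(2) show ?thesis by (simp add: algebra_simps)
  qed
  then show ?thesis by blast
qed

lemma window_occurs_everywhere:
  assumes "x \<in> admissible" "y \<in> admissible"
  shows "\<exists>s. \<forall>l. \<bar>l\<bar> \<le> N \<longrightarrow> y (s + l) = x l"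
proof -
  obtain n a j where *: "N \<le> j" "j + N < P ^ n" "\<And>l. \<bar>l\<bar> \<le> N \<Longrightarrow> x l = blk n a (j + l)"
    by (rule admissible_window[OF assms(1), of N]) blast
  obtain s where s: "\<And>q. 0 \<le> q \<and> q < P ^ n \<Longrightarrow> y (s + q) = blk n a q"
    using block_occurs_everywhere[OF assms(2)] by blast
  show ?thesis
  proof (intro exI allI impI)
    fix l assume "\<bar>l\<bar> \<le> N"
    then have "0 \<le> j + l \<and> j + l < P ^ n" using * by linarith
    then show "y (s + j + l) = x l" using * s \<open>\<bar>l\<bar> \<le> N\<close> by (simp add: add.assoc)
  qed
qed

lemma admissible_nonempty: "admissible \<noteq> {}"
proof -
  obtain b :: 'a where True by simp
  define f where "f N l = (if 0 \<le> l + int N \<and> l + int N < P ^ (2 * N + 1) then blk (2 * N + 1) b (l + int N) else b)"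
    for N l
  obtain r :: "nat \<Rightarrow> nat" and z where r: "strict_mono r" and z: "\<And>M. \<exists>K. \<forall>k\<ge>K. \<forall>l. \<bar>l\<bar> \<le> M \<longrightarrow> f (r k) l = z l"
    using pointwise_convergent_subsequence[of f] by blast
  have "z \<in> admissible"
  proof (rule admissibleI[of 0])
    fix N :: int assume "N \<ge> 0"
    obtain K where K: "\<forall>k\<ge>K. \<forall>l. \<bar>l\<bar> \<le> N \<longrightarrow> f (r k) l = z l" using z by blast
    define k where "k = max K (nat N)"
    have k: "int (r k) \<ge> N" using seq_suble[OF r, of k] unfolding k_def by linarith
    have lt: "int (2 * r k + 1) < P ^ (2 * r k + 1)" by (rule P_power_ge)
    show "\<exists>n a j. N \<le> j \<and> j + N < P ^ n \<and> (\<forall>l. \<bar>l\<bar> \<le> N \<longrightarrow> z l = blk n a (j + l))"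
    proof (intro exI conjI allI impI)
      show "N \<le> int (r k)" by (rule k)
      show "int (r k) + N < P ^ (2 * r k + 1)" using lt k by linarith
      fix l assume l: "\<bar>l\<bar> \<le> N"
      then have "z l = f (r k) l" using K by (simp add: k_def)
      moreover have "l + int (r k) < P ^ (2 * r k + 1)" using lt k l by linarith
      ultimately show "z l = blk (2 * r k + 1) b (int (r k) + l)"
        using k l by (simp only: f_def) (auto simp: add.commute)
    qed
  qed
  then show ?thesis by auto
qed

lemma subshift_admissible: "subshift admissible"
proof -
  have "shift ` admissible = admissible"
  proof
    show "admissible \<subseteq> shift ` admissible"
    proof
      fix x assume "x \<in> admissible"
      then have "shift_iter (-1) x \<in> admissible" "x = shift (shift_iter (-1) x)"
        by (auto intro: admissible_shift simp: shift_eq_shift_iter)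
      then show "x \<in> shift ` admissible" by blast
    qed
  qed (auto intro: admissible_shift simp: shift_eq_shift_iter)
  moreover have "closedin full_shift_topology admissible"
    unfolding closedin_full_shift_iff
  proof (intro allI impI)
    fix x :: "int \<Rightarrow> 'a" assume "\<forall>M. \<exists>y\<in>admissible. \<forall>l. \<bar>l\<bar> \<le> M \<longrightarrow> y l = x l"
    then show "x \<in> admissible" by (intro admissible_closed) metis
  qed
  ultimately show ?thesis by (simp add: subshift_def)
qed

text \<open>The admissible points form a subshift of the required kind, and they lie in each such subshift
  because it is closed under shifts and limits.\<close>

lemma subst_shift_eq_admissible: "subst_shift \<tau> = admissible"
proof (rule antisym)
  have "appears_in (subst_pow \<tau> n a) admissible" for n a
  proof -
    obtain y where y: "y \<in> admissible" using admissible_nonempty by auto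
    obtain s where s: "\<And>q. 0 \<le> q \<and> q < P ^ n \<Longrightarrow> y (s + q) = blk n a q"
      using block_occurs_everywhere[OF y] by blast
    show ?thesis unfolding appears_in_def
    proof (intro bexI exI allI impI)
      fix j assume "j < length (subst_pow \<tau> n a)"
      then have "int j < P ^ n" unfolding length_subst_pow by (metis of_nat_less_iff of_nat_power)
      then show "y (s + int j) = subst_pow \<tau> n a ! j" using s[of "int j"] by (simp add: blk_def)
    qed (rule y)
  qed
  then show "subst_shift \<tau> \<subseteq> admissible" using subshift_admissible by (auto simp: subst_shift_def)
next
  show "admissible \<subseteq> subst_shift \<tau>"
    unfolding subst_shift_def
  proof (intro subsetI InterI, elim CollectE conjE)
    fix x Y assume x: "x \<in> admissible" and Y: "subshift Y" "\<forall>n a. appears_in (subst_pow \<tau> n a) Y"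
    have "\<exists>y\<in>Y. \<forall>l. \<bar>l\<bar> \<le> M \<longrightarrow> y l = x l" for M
    proof -
      obtain n a j where *: "M \<le> j" "j + M < P ^ n" "\<And>l. \<bar>l\<bar> \<le> M \<Longrightarrow> x l = blk n a (j + l)"
        by (rule admissible_window[OF x, of M]) blast
      obtain y i where y: "y \<in> Y" "\<And>t. t < p ^ n \<Longrightarrow> y (i + int t) = subst_pow \<tau> n a ! t"
        using Y(2) unfolding appears_in_def length_subst_pow by blast
      have "y (i + j + l) = x l" if "\<bar>l\<bar> \<le> M" for l
      proof -
        have "0 \<le> j + l" "j + l < P ^ n" using * that by auto
        then have "nat (j + l) < p ^ n" by (metis nat_less_iff of_nat_power)
        then show ?thesis using y(2)[of "nat (j + l)"] * that \<open>0 \<le> j + l\<close>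
          by (simp add: blk_def add.assoc)
      qed
      then have "\<forall>l. \<bar>l\<bar> \<le> M \<longrightarrow> shift_iter (i + j) y l = x l"
        by (simp add: shift_iter_def add.commute)
      then show ?thesis using subshift_shift_iter[OF Y(1) y(1)] by blast
    qed
    then show "x \<in> Y" using Y(1) unfolding subshift_def closedin_full_shift_iff by blast
  qed
qed

section \<open>Factor complexity\<close>

definition words :: "nat \<Rightarrow> (int \<Rightarrow> 'a) set" where
  "words n = (\<lambda>x. restrict x {0..<int n}) ` admissible"

lemma finite_words: "finite (words n)"
proof (rule finite_subset)
  show "words n \<subseteq> PiE {0..<int n} (\<lambda>_. UNIV)" by (auto simp: words_def)
  show "finite (PiE {0..<int n} (\<lambda>_. UNIV :: 'a set))" by (intro finite_PiE) auto
qed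

lemma restrict_eq_iff: "restrict x A = restrict y A \<longleftrightarrow> (\<forall>t\<in>A. x t = y t)"
  by (metis restrict_apply' restrict_ext)

text \<open>If the number of words does not grow from length \<open>n\<close> to \<open>n + 1\<close> then both ways of shortening
  a word by one letter are injective, so every word extends uniquely to the right and to the
  left, and a point is determined by any of its windows of length \<open>n\<close>.\<close>

lemma complexity_strict_mono:
  assumes inf: "infinite admissible"
  shows "card (words n) < card (words (Suc n))"
proof (rule ccontr)
  assume "\<not> ?thesis"
  then have le: "card (words (Suc n)) \<le> card (words n)" by simp
  define R where "R w = restrict w {0..<int n}" for w :: "int \<Rightarrow> 'a"
  define L where "L w = restrict (\<lambda>t. w (t + 1)) {0..<int n}" for w :: "int \<Rightarrow> 'a"
  have R: "R (restrict x {0..<int (Suc n)}) = restrict x {0..<int n}" for x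
    by (auto simp: R_def fun_eq_iff)
  have L: "L (restrict x {0..<int (Suc n)}) = restrict (shift_iter 1 x) {0..<int n}" for x
    by (auto simp: L_def fun_eq_iff shift_iter_def restrict_def)
  have surR: "R ` words (Suc n) = words n"
    unfolding words_def image_image R ..
  have "shift_iter 1 ` admissible = admissible"
  proof
    show "admissible \<subseteq> shift_iter 1 ` admissible"
    proof
      fix x assume "x \<in> admissible"
      then have "shift_iter (-1) x \<in> admissible" "x = shift_iter 1 (shift_iter (-1) x)"
        by (auto intro: admissible_shift)
      then show "x \<in> shift_iter 1 ` admissible" by blast
    qed
  qed (auto intro: admissible_shift)
  moreover have "L ` words (Suc n) = (\<lambda>x. restrict x {0..<int n}) ` (shift_iter 1 ` admissible)"
    unfolding words_def image_image L ..
  ultimately have surL: "L ` words (Suc n) = words n" by (simp add: words_def)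
  have "inj_on R (words (Suc n))"
    using le surR by (intro eq_card_imp_inj_on finite_words) (metis card_image_le finite_words antisym)
  then have right: "x (int n) = y (int n)"
    if "x \<in> admissible" "y \<in> admissible" "\<forall>t\<in>{0..<int n}. x t = y t" for x y
  proof -
    have "restrict x {0..<int (Suc n)} = restrict y {0..<int (Suc n)}"
    proof (rule inj_onD[OF \<open>inj_on R _\<close>])
      show "R (restrict x {0..<int (Suc n)}) = R (restrict y {0..<int (Suc n)})"
        using that(3) unfolding R restrict_eq_iff .
    qed (use that in \<open>auto simp: words_def\<close>)
    then have "\<forall>t\<in>{0..<int (Suc n)}. x t = y t" unfolding restrict_eq_iff .
    then show ?thesis by auto
  qed
  have "inj_on L (words (Suc n))"
    using le surL by (intro eq_card_imp_inj_on finite_words) (metis card_image_le finite_words antisym)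
  then have left: "x (-1) = y (-1)"
    if "x \<in> admissible" "y \<in> admissible" "\<forall>t\<in>{0..<int n}. x t = y t" for x y
  proof -
    have "restrict (shift_iter (-1) x) {0..<int (Suc n)} = restrict (shift_iter (-1) y) {0..<int (Suc n)}"
    proof (rule inj_onD[OF \<open>inj_on L _\<close>])
      show "L (restrict (shift_iter (-1) x) {0..<int (Suc n)}) = L (restrict (shift_iter (-1) y) {0..<int (Suc n)})"
        using that(3) unfolding L restrict_eq_iff by (simp add: shift_iter_def)
    qed (use that in \<open>auto simp: words_def intro: admissible_shift\<close>)
    then have "\<forall>t\<in>{0..<int (Suc n)}. shift_iter (-1) x t = shift_iter (-1) y t"
      unfolding restrict_eq_iff .
    then show ?thesis by (auto simp: shift_iter_def dest: bspec[of _ _ 0])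
  qed
  have step: "\<forall>t\<in>{0..<int n}. shift_iter k x t = shift_iter k y t"
    if xy: "x \<in> admissible" "y \<in> admissible" "\<forall>t\<in>{0..<int n}. x t = y t" for x y k
  proof -
    have "\<forall>t\<in>{0..<int n}. shift_iter (int k) x t = shift_iter (int k) y t" for k
    proof (induction k)
      case (Suc k)
      have "shift_iter (int k) x (int n) = shift_iter (int k) y (int n)"
        using Suc xy by (intro right admissible_shift)
      then have "\<forall>t\<in>{0..<int n + 1}. shift_iter (int k) x t = shift_iter (int k) y t"
        using Suc by (metis atLeastLessThan_iff linorder_neqE_linordered_idom not_less zless_add1_eq)
      then have *: "\<forall>t\<in>{0..<int n}. shift_iter (int k) x (t + 1) = shift_iter (int k) y (t + 1)"
        by auto
      then show ?case by (simp add: shift_iter_def algebra_simps)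
    qed (use xy in simp)
    moreover have "\<forall>t\<in>{0..<int n}. shift_iter (- int k) x t = shift_iter (- int k) y t" for k
    proof (induction k)
      case (Suc k)
      have *: "shift_iter (- int k) x (-1) = shift_iter (- int k) y (-1)"
        using Suc xy by (intro left admissible_shift)
      have "shift_iter (- int k) x (t - 1) = shift_iter (- int k) y (t - 1)" if "t \<in> {0..<int n}" for t
        using that Suc * by (cases "t = 0") auto
      then show ?case by (simp add: shift_iter_def algebra_simps)
    qed (use xy in simp)
    ultimately show ?thesis by (metis int_cases2)
  qed
  have "inj_on (\<lambda>x. restrict x {0..<int (Suc n)}) admissible"
  proof (rule inj_onI, rule ext)
    fix x y and k :: int assume xy: "x \<in> admissible" "y \<in> admissible"
      and "restrict x {0..<int (Suc n)} = restrict y {0..<int (Suc n)}"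
    then have "\<forall>t\<in>{0..<int (Suc n)}. x t = y t" by (simp only: restrict_eq_iff)
    then have "\<forall>t\<in>{0..<int n}. x t = y t" by auto
    then have "shift_iter (k - n) x (int n) = shift_iter (k - n) y (int n)"
      by (intro right admissible_shift step xy)
    then show "x k = y k" by (simp add: shift_iter_def)
  qed
  then show False using inf finite_words[of "Suc n"] finite_imageD unfolding words_def by blast
qed

lemma complexity_ge:
  assumes "infinite admissible"
  shows "n \<le> card (words n)"
proof (induction n)
  case (Suc n)
  then show ?case using complexity_strict_mono[OF assms, of n] by linarith
qed simp

section \<open>Recognizability\<close>

text \<open>If some point can be parsed into blocks at two different offsets then, by minimality, one of
  the \<open>q\<close> offsets is superfluous for producing words: a word starting at the last offset also
  starts at another one.\<close>

lemma complexity_le_of_double_parsing: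
  assumes q: "q = p ^ n" and d: "0 < d" "d < int q"
    and uv: "u \<in> admissible" "v \<in> admissible" "inflate n u = shift_iter d (inflate n v)"
  shows "card (words (q * N)) \<le> (q - 1) * card (words (Suc N))"
proof -
  have Q: "P ^ n = int q" using q by simp
  have q0: "int q > 0" using d by linarith
  define g where "g i w = restrict (\<lambda>t. inflate n w (t + i)) {0..<int (q * N)}" for i and w :: "int \<Rightarrow> 'a"
  have bounds: "0 \<le> (t + i) div int q" "(t + i) div int q < int (Suc N)"
    if "t \<in> {0..<int (q * N)}" "0 \<le> i" "i < int q" for t i
  proof -
    show "0 \<le> (t + i) div int q" using that q0 by (simp add: pos_imp_zdiv_nonneg_iff)
    have "t + i < int (Suc N) * int q" using that by (simp add: algebra_simps)
    moreover have "(t + i) div int q * int q \<le> t + i"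
      using div_mult_mod_eq[of "t + i" "int q"] pos_mod_sign[OF q0, of "t + i"] by linarith
    ultimately have "(t + i) div int q * int q < int (Suc N) * int q" by linarith
    then show "(t + i) div int q < int (Suc N)" using q0 mult_right_less_imp_less by (metis less_imp_le)
  qed
  have g: "g i (restrict x {0..<int (Suc N)}) = g i x" if "0 \<le> i" "i < int q" for i x
    using bounds that unfolding g_def by (intro restrict_ext) (auto simp: inflate_def Q)
  have "words (q * N) \<subseteq> (\<Union>i\<in>{0..<int q - 1}. g i ` words (Suc N))"
  proof
    fix w assume "w \<in> words (q * N)"
    then obtain x where x: "x \<in> admissible" "w = restrict x {0..<int (q * N)}" by (auto simp: words_def)
    obtain i x' where i: "0 \<le> i" "i < P ^ n" "x' \<in> admissible" "x = shift_iter i (inflate n x')"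
      using admissible_desubstitute[OF x(1)] by blast
    have "\<exists>i' y. 0 \<le> i' \<and> i' < int q - 1 \<and> y \<in> admissible \<and> w = g i' y"
    proof (cases "i < int q - 1")
      case True
      then show ?thesis using i x by (intro exI[of _ i] exI[of _ x']) (auto simp: g_def shift_iter_def)
    next
      case False
      then have iq: "i = int q - 1" using i Q by linarith
      obtain s where s: "\<And>l. \<bar>l\<bar> \<le> int (Suc N) \<Longrightarrow> u (s + l) = x' l"
        using window_occurs_everywhere[OF i(3) uv(1), of "int (Suc N)"] by blast
      have "w t = g (d - 1) (shift_iter (s + 1) v) t" for t
      proof (cases "t \<in> {0..<int (q * N)}")
        case True
        have "w t = inflate n x' (t + i)" using True x i by (simp add: shift_iter_def)
        also have "\<dots> = inflate n (shift_iter s u) (t + i)"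
          using s bounds[OF True] i(1,2) unfolding inflate_def Q shift_iter_def
          by (smt (verit, best) add.commute)
        also have "\<dots> = inflate n u (t + i + s * int q)"
          unfolding inflate_shift by (simp add: shift_iter_def Q)
        also have "\<dots> = inflate n v (t + (d - 1) + (s + 1) * int q)"
          unfolding uv(3) by (simp add: shift_iter_def iq algebra_simps)
        also have "\<dots> = g (d - 1) (shift_iter (s + 1) v) t"
          using True unfolding g_def inflate_shift by (simp add: shift_iter_def Q)
        finally show ?thesis .
      qed (use x in \<open>auto simp: g_def\<close>)
      then have "w = g (d - 1) (shift_iter (s + 1) v)" by blast
      then show ?thesis using d uv admissible_shift by (intro exI[of _ "d - 1"]) auto
    qed
    then obtain i' y where y: "0 \<le> i'" "i' < int q - 1" "y \<in> admissible" "w = g i' y" by blast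
    then have "w = g i' (restrict y {0..<int (Suc N)})" using g by simp
    then show "w \<in> (\<Union>i\<in>{0..<int q - 1}. g i ` words (Suc N))"
    proof (intro UN_I[of i'])
      have "restrict y {0..<int (Suc N)} \<in> words (Suc N)" using y(3) unfolding words_def by (rule imageI)
      then show "w \<in> g i' ` words (Suc N)"
        using \<open>w = g i' (restrict y {0..<int (Suc N)})\<close> by (simp only: imageI)
    qed (use y in simp)
  qed
  then have "card (words (q * N)) \<le> card (\<Union>i\<in>{0..<int q - 1}. g i ` words (Suc N))"
    by (intro card_mono) (auto simp: finite_words)
  also have "\<dots> \<le> (\<Sum>i\<in>{0..<int q - 1}. card (g i ` words (Suc N)))"
    by (intro card_UN_le) auto
  also have "\<dots> \<le> (\<Sum>i\<in>{0..<int q - 1}. card (words (Suc N)))"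
    by (intro sum_mono card_image_le finite_words)
  also have "\<dots> = (q - 1) * card (words (Suc N))"
    using q0 by (simp add: nat_diff_distrib)
  finally show ?thesis .
qed

lemma power_outgrows_pred_power:
  fixes q c :: nat
  assumes "q \<ge> 1"
  shows "\<exists>k. (q - 1) ^ k * c < q ^ k"
proof -
  have "(\<lambda>k. (real (q - 1) / real q) ^ k * c) \<longlonglongrightarrow> 0 * real c"
    using assms by (intro tendsto_mult LIMSEQ_power_zero tendsto_const) (auto simp: field_simps of_nat_diff)
  then have "eventually (\<lambda>k. (real (q - 1) / real q) ^ k * c < 1) sequentially"
    by (intro order_tendstoD) auto
  then obtain k where "(real (q - 1) / real q) ^ k * c < 1"
    by (meson eventually_happens' sequentially_bot)
  then have "real ((q - 1) ^ k * c) < real (q ^ k)"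
    using assms by (simp add: power_divide field_simps)
  then show ?thesis by (intro exI[of _ k]) (simp only: of_nat_less_iff)
qed

text \<open>A superfluous offset would make the complexity grow by a factor of at most \<open>q - 1\<close> whenever
  the length grows by a factor of about \<open>q\<close>, hence sublinearly, which is impossible for an
  infinite subshift.\<close>

lemma recognizability:
  assumes inf: "infinite admissible"
    and uv: "u \<in> admissible" "v \<in> admissible"
    and ij: "0 \<le> i" "i < P ^ n" "0 \<le> j" "j < P ^ n"
    and eq: "shift_iter i (inflate n u) = shift_iter j (inflate n v)"
  shows "i = j"
proof -
  have wlog: False if uv: "u \<in> admissible" "v \<in> admissible" and ij: "0 \<le> i" "i < j" "j < P ^ n"
    and eq: "shift_iter i (inflate n u) = shift_iter j (inflate n v)" for u v i j
  proof -
    define q where "q = p ^ n"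
    define d where "d = j - i"
    have "shift_iter (- i) (shift_iter i (inflate n u)) = shift_iter (- i) (shift_iter j (inflate n v))"
      using eq by (rule arg_cong)
    then have "inflate n u = shift_iter d (inflate n v)" by (simp add: d_def)
    moreover have d: "0 < d" "d < int q" using ij by (auto simp: d_def q_def)
    ultimately have cw: "card (words (q * N)) \<le> (q - 1) * card (words (Suc N))" for N
      using complexity_le_of_double_parsing[OF q_def] uv by blast
    have q2: "q \<ge> 2" using d by linarith
    \<comment> \<open>The map \<open>N + 1 \<mapsto> q * N\<close> on lengths is expanding from length \<open>3\<close> on.\<close>
    have "\<exists>N. q ^ k + 1 \<le> N \<and> card (words (Suc N)) \<le> (q - 1) ^ k * card (words 3)" for k
    proof (induction k)
      case 0
      show ?case by (intro exI[of _ 2]) (simp add: numeral_3_eq_3 numeral_2_eq_2)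
    next
      case (Suc k)
      then obtain N where N: "q ^ k + 1 \<le> N" "card (words (Suc N)) \<le> (q - 1) ^ k * card (words 3)" by blast
      have "q * (q ^ k + 1) \<le> q * N" using N by (intro mult_left_mono) auto
      then have "q ^ Suc k + 1 \<le> q * N - 1" using q2 by (simp add: algebra_simps)
      moreover have "card (words (Suc (q * N - 1))) \<le> (q - 1) ^ Suc k * card (words 3)"
      proof -
        have "card (words (q * N)) \<le> (q - 1) * ((q - 1) ^ k * card (words 3))"
          using cw[of N] N by (meson le_trans mult_le_mono2)
        moreover have "Suc (q * N - 1) = q * N" using N q2 by simp
        ultimately show ?thesis by simp
      qed
      ultimately show ?case by blast
    qed
    moreover obtain k where k: "(q - 1) ^ k * card (words 3) < q ^ k"
      using power_outgrows_pred_power q2 by (metis one_le_numeral order_trans)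
    ultimately obtain N where "q ^ k + 1 \<le> N" "card (words (Suc N)) < q ^ k"
      by (meson le_less_trans)
    then show False using complexity_ge[OF inf, of "Suc N"] by linarith
  qed
  show ?thesis
  proof (rule linorder_cases[of i j])
    assume "i < j"
    then show ?thesis using wlog[OF uv ij(1) _ ij(4) eq] by blast
  next
    assume "j < i"
    then show ?thesis using wlog[OF uv(2,1) ij(3) _ ij(2) eq[symmetric]] by blast
  qed
qed

end

section \<open>Compatible metrics and agreement on windows\<close>

definition eq_on_window :: "int \<Rightarrow> (int \<Rightarrow> 'a) \<Rightarrow> (int \<Rightarrow> 'a) \<Rightarrow> bool" where
  "eq_on_window M x y \<longleftrightarrow> (\<forall>l. \<bar>l\<bar> \<le> M \<longrightarrow> x l = y l)"

lemma openin_compatible_cylinder: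
  assumes "compatible_metric X d"
  shows "openin (Metric_space.mtopology X d) {y \<in> X. eq_on_window M y x}"
proof -
  have "openin (subtopology full_shift_topology X) ({y. \<forall>l. \<bar>l\<bar> \<le> M \<longrightarrow> y l = x l} \<inter> X)"
    by (intro openin_subtopology_Int openin_full_shift_cylinder)
  moreover have "{y. \<forall>l. \<bar>l\<bar> \<le> M \<longrightarrow> y l = x l} \<inter> X = {y \<in> X. eq_on_window M y x}"
    by (auto simp: eq_on_window_def)
  ultimately show ?thesis using assms by (simp add: compatible_metric_def)
qed

lemma compactin_compatible:
  fixes X :: "(int \<Rightarrow> 'a::finite) set"
  assumes "compatible_metric X d" "closedin full_shift_topology X"
  shows "compactin (Metric_space.mtopology X d) X"
proof -
  have "compactin full_shift_topology X"
    using assms(2) compact_space_full_shift closedin_compact_space by blast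
  then show ?thesis
    using assms(1) by (simp add: compatible_metric_def compactin_subtopology)
qed

lemma small_distance_imp_eq_on_window:
  fixes X :: "(int \<Rightarrow> 'a::finite) set"
  assumes comp: "compatible_metric X d" and cl: "closedin full_shift_topology X"
  obtains \<delta> where "\<delta> > 0" "\<And>x y. x \<in> X \<Longrightarrow> y \<in> X \<Longrightarrow> d x y < \<delta> \<Longrightarrow> eq_on_window M x y"
proof -
  interpret Metric_space X d using comp by (simp add: compatible_metric_def)
  define \<C> where "\<C> = (\<lambda>x. {y \<in> X. eq_on_window M y x}) ` X"
  have "\<exists>\<delta>>0. \<forall>x\<in>X. \<exists>U\<in>\<C>. mball x \<delta> \<subseteq> U"
  proof (rule lebesgue_number[OF compactin_compatible[OF comp cl]])
    show "X \<subseteq> \<Union>\<C>" by (auto simp: \<C>_def eq_on_window_def)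
    show "\<And>U. U \<in> \<C> \<Longrightarrow> openin mtopology U"
      using openin_compatible_cylinder[OF comp] by (auto simp: \<C>_def)
  qed
  then obtain \<delta> where "\<delta> > 0" and \<delta>: "\<And>x. x \<in> X \<Longrightarrow> \<exists>U \<in> \<C>. mball x \<delta> \<subseteq> U" by blast
  show ?thesis
  proof (rule that[OF \<open>\<delta> > 0\<close>])
    fix x y assume xy: "x \<in> X" "y \<in> X" "d x y < \<delta>"
    obtain U where U: "U \<in> \<C>" "mball x \<delta> \<subseteq> U" using \<delta> xy(1) by blast
    then obtain c where "\<And>z. z \<in> U \<Longrightarrow> eq_on_window M z c" by (auto simp: \<C>_def)
    moreover have "x \<in> U" "y \<in> U" using U xy \<open>\<delta> > 0\<close> by (auto simp: subset_iff in_mball)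
    ultimately show "eq_on_window M x y" unfolding eq_on_window_def by metis
  qed
qed

lemma eq_on_window_imp_small_distance:
  fixes X :: "(int \<Rightarrow> 'a::finite) set"
  assumes comp: "compatible_metric X d" and cl: "closedin full_shift_topology X" and e: "e > 0"
  obtains M where "\<And>x y. x \<in> X \<Longrightarrow> y \<in> X \<Longrightarrow> eq_on_window M x y \<Longrightarrow> d x y < e"
proof -
  interpret Metric_space X d using comp by (simp add: compatible_metric_def)
  have top: "mtopology = subtopology full_shift_topology X" using comp by (simp add: compatible_metric_def)
  have "\<exists>M. \<forall>y\<in>X. eq_on_window M y x \<longrightarrow> d x y < e / 2" if "x \<in> X" for x
  proof -
    have "openin mtopology (mball x (e / 2))" by simp
    then obtain U where U: "openin full_shift_topology U" "mball x (e / 2) = U \<inter> X"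
      unfolding top openin_subtopology by blast
    moreover have "x \<in> mball x (e / 2)" using that e by simp
    ultimately obtain M where M: "\<And>y. (\<And>l. \<bar>l\<bar> \<le> M \<Longrightarrow> y l = x l) \<Longrightarrow> y \<in> U"
      using full_shift_openD[of U x] by blast
    then have "\<forall>y\<in>X. eq_on_window M y x \<longrightarrow> y \<in> mball x (e / 2)"
      unfolding U(2) eq_on_window_def by blast
    then show ?thesis by (metis in_mball)
  qed
  then obtain B where B: "\<And>x y. x \<in> X \<Longrightarrow> y \<in> X \<Longrightarrow> eq_on_window (B x) y x \<Longrightarrow> d x y < e / 2"
    by metis
  define C where "C x = {y \<in> X. eq_on_window (B x) y x}" for x
  have "\<exists>\<F>. finite \<F> \<and> \<F> \<subseteq> C ` X \<and> X \<subseteq> \<Union>\<F>"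
  proof (rule compactinD[OF compactin_compatible[OF comp cl]])
    show "X \<subseteq> \<Union>(C ` X)" by (auto simp: C_def eq_on_window_def)
  qed (use openin_compatible_cylinder[OF comp] in \<open>auto simp: C_def\<close>)
  then obtain F where F: "finite F" "F \<subseteq> X" "X \<subseteq> \<Union>(C ` F)"
    by (metis finite_subset_image)
  show ?thesis
  proof (rule that[of "Max (insert 0 (B ` F))"])
    fix x y assume xy: "x \<in> X" "y \<in> X" "eq_on_window (Max (insert 0 (B ` F))) x y"
    obtain c where c: "c \<in> F" "eq_on_window (B c) x c" using F(3) xy(1) by (auto simp: C_def)
    have "B c \<le> Max (insert 0 (B ` F))" using c F by (intro Max_ge insertI2 imageI) auto
    then have "eq_on_window (B c) y c" using c(2) xy(3) by (auto simp: eq_on_window_def)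
    then have "d c x < e / 2" "d c y < e / 2" using B c F xy by auto
    moreover have "d x y \<le> d x c + d c y" using c F xy by (intro triangle) auto
    moreover have "d x c = d c x" by (rule commute)
    ultimately show "d x y < e" by linarith
  qed
qed

text \<open>Small distance and agreement on a long window control each other uniformly on the compact
  subshift, so that positivity of the upper limit and vanishing of the lower limit become conditions
  on the coordinates.\<close>

lemma li_yorke_iff:
  fixes X :: "(int \<Rightarrow> 'a::finite) set"
  assumes comp: "compatible_metric X d" and sub: "subshift X" and xy: "x \<in> X" "y \<in> X"
  shows "li_yorke d x y \<longleftrightarrow>
    (\<forall>B. \<exists>l\<ge>B. x l \<noteq> y l) \<and> (\<forall>N B. \<exists>s\<ge>B. \<forall>l. s \<le> l \<and> l \<le> s + N \<longrightarrow> x l = y l)"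
    (is "_ \<longleftrightarrow> ?dis \<and> ?agr")
proof -
  have cl: "closedin full_shift_topology X" using sub by (simp add: subshift_def)
  interpret Metric_space X d using comp by (simp add: compatible_metric_def)
  define D where "D n = d (shift_iter (int n) x) (shift_iter (int n) y)" for n
  have X: "shift_iter k x \<in> X" "shift_iter k y \<in> X" for k
    using subshift_shift_iter[OF sub] xy by auto
  have LY: "li_yorke d x y \<longleftrightarrow> limsup (\<lambda>n. ereal (D n)) > 0 \<and> liminf (\<lambda>n. ereal (D n)) = 0"
    by (simp add: li_yorke_def D_def shift_iter_nat)
  have D0: "D n \<ge> 0" for n by (simp add: D_def)
  have liminf0: "liminf (\<lambda>n. ereal (D n)) \<ge> 0"
    by (intro Liminf_bounded always_eventually) (simp add: D0)
  have "limsup (\<lambda>n. ereal (D n)) > 0 \<longleftrightarrow> ?dis"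
  proof
    assume L: "limsup (\<lambda>n. ereal (D n)) > 0"
    show ?dis
    proof (rule ccontr)
      assume "\<not> ?dis"
      then obtain B where B: "\<And>l. l \<ge> B \<Longrightarrow> x l = y l" by blast
      have small: "limsup (\<lambda>n. ereal (D n)) \<le> ereal e" if e: "e > 0" for e
      proof -
        obtain M where M: "\<And>x y. x \<in> X \<Longrightarrow> y \<in> X \<Longrightarrow> eq_on_window M x y \<Longrightarrow> d x y < e"
          using eq_on_window_imp_small_distance[OF comp cl e] by blast
        have "eventually (\<lambda>n. n \<ge> nat (B + \<bar>M\<bar>)) sequentially" by (rule eventually_ge_at_top)
        then have "eventually (\<lambda>n. ereal (D n) \<le> ereal e) sequentially"
        proof eventually_elim
          case (elim n)
          then have "B + \<bar>M\<bar> \<le> int n" by linarith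
          then have "eq_on_window M (shift_iter n x) (shift_iter n y)"
            using B by (auto simp: eq_on_window_def shift_iter_def)
          then show ?case using M X by (auto simp: D_def intro: less_imp_le)
        qed
        then show ?thesis by (rule Limsup_bounded)
      qed
      have "limsup (\<lambda>n. ereal (D n)) \<le> 0"
        by (rule ereal_le_epsilon2, unfold add_0, rule small)
      then show False using L by simp
    qed
  next
    assume dis: ?dis
    obtain \<delta> where \<delta>: "\<delta> > 0" "\<And>x y. x \<in> X \<Longrightarrow> y \<in> X \<Longrightarrow> d x y < \<delta> \<Longrightarrow> eq_on_window 0 x y"
      using small_distance_imp_eq_on_window[OF comp cl] by blast
    have "limsup (\<lambda>n. ereal (D n)) \<ge> ereal \<delta>"
    proof (rule ccontr)
      assume "\<not> ?thesis"
      then have "eventually (\<lambda>n. ereal (D n) < ereal \<delta>) sequentially" by (intro Limsup_lessD) auto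
      then obtain n0 where n0: "\<And>n. n \<ge> n0 \<Longrightarrow> D n < \<delta>" by (auto simp: eventually_sequentially)
      obtain l where l: "l \<ge> int n0" "x l \<noteq> y l" using dis by blast
      have "eq_on_window 0 (shift_iter (int (nat l)) x) (shift_iter (int (nat l)) y)"
        using n0[of "nat l"] l X by (intro \<delta>) (auto simp: D_def)
      then show False using l by (auto simp: eq_on_window_def shift_iter_def)
    qed
    then show "limsup (\<lambda>n. ereal (D n)) > 0" using \<delta>(1) by (meson ereal_less(2) less_le_trans)
  qed
  moreover have "liminf (\<lambda>n. ereal (D n)) = 0 \<longleftrightarrow> ?agr"
  proof
    assume L: "liminf (\<lambda>n. ereal (D n)) = 0"
    show ?agr
    proof (intro allI)
      fix N B :: int
      define M where "M = \<bar>N\<bar>"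
      obtain \<delta> where \<delta>: "\<delta> > 0" "\<And>x y. x \<in> X \<Longrightarrow> y \<in> X \<Longrightarrow> d x y < \<delta> \<Longrightarrow> eq_on_window M x y"
        using small_distance_imp_eq_on_window[OF comp cl] by blast
      have "\<exists>n\<ge>nat B. D n < \<delta>"
      proof (rule ccontr)
        assume "\<not> ?thesis"
        then have "eventually (\<lambda>n. ereal \<delta> \<le> ereal (D n)) sequentially"
          by (auto simp: eventually_sequentially not_less)
        then have "ereal \<delta> \<le> liminf (\<lambda>n. ereal (D n))" by (rule Liminf_bounded)
        then show False using L \<delta>(1) by simp
      qed
      then obtain n where n: "n \<ge> nat B" "D n < \<delta>" by blast
      then have "eq_on_window M (shift_iter n x) (shift_iter n y)" using \<delta> X by (simp add: D_def)
      then have "x l = y l" if "int n \<le> l" "l \<le> int n + N" for l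
        using that by (auto simp: eq_on_window_def shift_iter_def M_def dest: spec[of _ "l - n"])
      then show "\<exists>s\<ge>B. \<forall>l. s \<le> l \<and> l \<le> s + N \<longrightarrow> x l = y l"
        using n(1) by (intro exI[of _ "int n"]) auto
    qed
  next
    assume agr: ?agr
    have small: "liminf (\<lambda>n. ereal (D n)) \<le> ereal e" if e: "e > 0" for e
    proof (rule ccontr)
      assume "\<not> ?thesis"
      then have "eventually (\<lambda>n. ereal e < ereal (D n)) sequentially" by (intro less_LiminfD) auto
      then obtain n0 where n0: "\<And>n. n \<ge> n0 \<Longrightarrow> e < D n" by (auto simp: eventually_sequentially)
      obtain M where M: "\<And>x y. x \<in> X \<Longrightarrow> y \<in> X \<Longrightarrow> eq_on_window M x y \<Longrightarrow> d x y < e"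
        using eq_on_window_imp_small_distance[OF comp cl e] by blast
      obtain s where s: "s \<ge> int n0" "\<And>l. s \<le> l \<and> l \<le> s + 2 * \<bar>M\<bar> \<Longrightarrow> x l = y l"
        using agr by blast
      define n where "n = nat (s + \<bar>M\<bar>)"
      have "n \<ge> n0" "int n = s + \<bar>M\<bar>" using s(1) by (auto simp: n_def)
      have "x (l + int n) = y (l + int n)" if "\<bar>l\<bar> \<le> M" for l
        by (rule s(2)) (use that \<open>int n = s + \<bar>M\<bar>\<close> in linarith)
      then have "eq_on_window M (shift_iter n x) (shift_iter n y)"
        by (simp add: eq_on_window_def shift_iter_def)
      then show False using M X n0[OF \<open>n \<ge> n0\<close>] by (force simp: D_def)
    qed
    have "liminf (\<lambda>n. ereal (D n)) \<le> 0"
      by (rule ereal_le_epsilon2, unfold add_0, rule small)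
    then show "liminf (\<lambda>n. ereal (D n)) = 0" using liminf0 by simp
  qed
  ultimately show ?thesis unfolding LY by blast
qed

lemma uncountable_nat_sets: "uncountable (UNIV :: nat set set)"
proof
  assume "countable (UNIV :: nat set set)"
  then obtain f :: "nat set \<Rightarrow> nat" where f: "inj f" by (auto simp: countable_def)
  define S where "S = {f A | A. f A \<notin> A}"
  show False
  proof (cases "f S \<in> S")
    case True
    then obtain A where "f S = f A" "f A \<notin> A" unfolding S_def by blast
    then show False using f True by (metis injD)
  next
    case False
    then show False unfolding S_def by blast
  qed
qed

section \<open>Points addressed by sequences of digits\<close>

definition address :: "int \<Rightarrow> (nat \<Rightarrow> int) \<Rightarrow> nat \<Rightarrow> int" where
  "address Q e n = (\<Sum>j<n. e j * Q ^ j)"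

lemma address_Suc: "address Q e (Suc n) = address Q e n + e n * Q ^ n"
  by (simp add: address_def)

lemma address_0 [simp]: "address Q e 0 = 0"
  by (simp add: address_def)

lemma address_add: "address Q e (n + k) = address Q e n + address Q (\<lambda>i. e (n + i)) k * Q ^ n"
  by (induction k) (auto simp: address_Suc power_add algebra_simps)

text \<open>The conditions on consecutive pairs of digits force the interval of coordinates covered by
  the block of level \<open>n\<close> to grow in both directions.\<close>

definition spread_digits :: "int \<Rightarrow> (nat \<Rightarrow> int) \<Rightarrow> bool" where
  "spread_digits Q e \<longleftrightarrow> (\<forall>j. 0 \<le> e j \<and> e j < Q) \<and>
     (\<forall>k. 1 \<le> e (2 * k) + e (Suc (2 * k)) \<and> e (2 * k) + e (Suc (2 * k)) \<le> 2 * Q - 3)"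

lemma address_complement: "address Q (\<lambda>j. Q - 1 - e j) n = Q ^ n - 1 - address Q e n"
  by (induction n) (auto simp: address_Suc algebra_simps)

lemma spread_digitsD:
  assumes "spread_digits Q e"
  shows "0 \<le> e j" "e j < Q" "1 \<le> e (2 * k) + e (Suc (2 * k))"
    "e (2 * k) + e (Suc (2 * k)) \<le> 2 * Q - 3"
  using assms unfolding spread_digits_def by blast+

lemma spread_digits_complement:
  assumes "spread_digits Q e"
  shows "spread_digits Q (\<lambda>j. Q - 1 - e j)"
  unfolding spread_digits_def
proof (intro conjI allI)
  fix j k
  show "0 \<le> Q - 1 - e j" "Q - 1 - e j < Q"
    using spread_digitsD(1,2)[OF assms, of j] by linarith+
  show "1 \<le> Q - 1 - e (2 * k) + (Q - 1 - e (Suc (2 * k)))"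
    "Q - 1 - e (2 * k) + (Q - 1 - e (Suc (2 * k))) \<le> 2 * Q - 3"
    using spread_digitsD(3,4)[OF assms, of k] by linarith+
qed

lemma spread_digits_shift:
  assumes "spread_digits Q e"
  shows "spread_digits Q (\<lambda>j. e (2 * k + j))"
  unfolding spread_digits_def
proof (intro conjI allI)
  fix j i
  show "0 \<le> e (2 * k + j)" "e (2 * k + j) < Q"
    by (rule spread_digitsD[OF assms])+
  show "1 \<le> e (2 * k + 2 * i) + e (2 * k + Suc (2 * i))"
    "e (2 * k + 2 * i) + e (2 * k + Suc (2 * i)) \<le> 2 * Q - 3"
    using spread_digitsD(3,4)[OF assms, of "k + i"] by simp_all
qed

lemma address_mono:
  assumes "\<And>j. 0 \<le> e j \<and> e j < Q" "n \<le> n'"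
  shows "address Q e n \<le> address Q e n'"
  using assms(2)
proof (induction n' rule: dec_induct)
  case (step k)
  have "0 \<le> e k * Q ^ k" using assms(1)[of k] by simp
  then show ?case using step by (simp add: address_Suc)
qed simp

lemma address_ge:
  assumes "spread_digits Q e" "2 * k \<le> n"
  shows "int k \<le> address Q e n"
proof -
  have "int k \<le> address Q e (2 * k)"
  proof (induction k)
    case (Suc k)
    have e: "0 \<le> e (2 * k)" "0 \<le> e (Suc (2 * k))" "1 \<le> e (2 * k) + e (Suc (2 * k))" "Q \<ge> 1"
      using spread_digitsD(1,2)[OF assms(1)] spread_digitsD(3)[OF assms(1), of k]
      by (auto intro: order_trans[OF _ spread_digitsD(2)[OF assms(1), of 0, THEN zless_imp_add1_zle]])
    have "e (2 * k) * 1 \<le> e (2 * k) * Q ^ (2 * k)" "e (Suc (2 * k)) * 1 \<le> e (Suc (2 * k)) * Q ^ (Suc (2 * k))"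
      using e by (intro mult_left_mono one_le_power; simp)+
    then have "1 \<le> e (2 * k) * Q ^ (2 * k) + e (Suc (2 * k)) * Q ^ (Suc (2 * k))" using e by linarith
    then show ?case using Suc by (simp add: address_Suc)
  qed simp
  also have "\<dots> \<le> address Q e n" using address_mono spread_digitsD(1,2) assms by blast
  finally show ?thesis .
qed

lemma address_le:
  assumes "spread_digits Q e" "2 * k \<le> n"
  shows "address Q e n + int k < Q ^ n"
  using address_ge[OF spread_digits_complement[OF assms(1)] assms(2)] by (simp add: address_complement)

context primitive_subst_constant_length
begin

text \<open>The level \<open>2 * nat \<bar>l\<bar>\<close> is one at which the block placed around the origin is certain to
  cover the coordinate \<open>l\<close> (\<open>address_ge\<close> and \<open>address_le\<close>).\<close>

definition nested_point :: "nat \<Rightarrow> (nat \<Rightarrow> int) \<Rightarrow> 'a \<Rightarrow> int \<Rightarrow> 'a" where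
  "nested_point m e c l = (let n = 2 * nat \<bar>l\<bar> in blk (m * n) c (l + address (P ^ m) e n))"

text \<open>Under this condition the block of \<open>c\<close> of any level, placed with its position \<open>address\<close> at
  the origin, is extended by the block of \<open>c\<close> of the next level.\<close>

definition self_occurrences :: "nat \<Rightarrow> (nat \<Rightarrow> int) \<Rightarrow> 'a \<Rightarrow> bool" where
  "self_occurrences m e c \<longleftrightarrow> spread_digits (P ^ m) e \<and> (\<forall>j. blk m c (e j) = c)"

lemma self_occurrences_shift:
  "self_occurrences m e c \<Longrightarrow> self_occurrences m (\<lambda>j. e (2 * k + j)) c"
  unfolding self_occurrences_def using spread_digits_shift by blast

lemma blk_address_mult:
  assumes "0 \<le> l + address (P ^ m) e n" "l + address (P ^ m) e n < (P ^ m) ^ n" "0 \<le> i" "i < P ^ m"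
  shows "blk (m * Suc n) c (l + address (P ^ m) e n + i * (P ^ m) ^ n)
       = blk (m * n) (blk m c i) (l + address (P ^ m) e n)"
    "l + address (P ^ m) e n + i * (P ^ m) ^ n < (P ^ m) ^ Suc n"
  using blk_add_mult(1)[of "l + address (P ^ m) e n" "m * n" i m]
    blk_add_mult(2)[of "l + address (P ^ m) e n" "m * n" i m c] assms
  by (simp_all add: power_mult power_add add.commute mult.commute)

lemma blk_address_extend:
  assumes self: "self_occurrences m e c" and "n \<le> n'"
    and "0 \<le> l + address (P ^ m) e n" "l + address (P ^ m) e n < (P ^ m) ^ n"
  shows "0 \<le> l + address (P ^ m) e n' \<and> l + address (P ^ m) e n' < (P ^ m) ^ n' \<and>
    blk (m * n') c (l + address (P ^ m) e n') = blk (m * n) c (l + address (P ^ m) e n)"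
  using assms(2)
proof (induction n' rule: dec_induct)
  case (step k)
  have sp: "spread_digits (P ^ m) e" "blk m c (e k) = c" using self by (auto simp: self_occurrences_def)
  then have ek: "0 \<le> e k" "e k < P ^ m" using spread_digitsD(1,2) by blast+
  have "address (P ^ m) e k \<le> address (P ^ m) e (Suc k)" using spread_digitsD(1,2)[OF sp(1)] by (intro address_mono) auto
  then have "0 \<le> l + address (P ^ m) e (Suc k)" using step by linarith
  moreover have "l + address (P ^ m) e k + e k * (P ^ m) ^ k = l + address (P ^ m) e (Suc k)"
    by (simp add: address_Suc)
  ultimately show ?case using blk_address_mult(1)[of l m e k "e k" c] blk_address_mult(2)[of l m e k "e k"] step.IH ek sp(2) by metis
qed (use assms in auto)

lemma nested_point_eq:
  assumes self: "self_occurrences m e c"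
    and "0 \<le> l + address (P ^ m) e n" "l + address (P ^ m) e n < (P ^ m) ^ n"
  shows "nested_point m e c l = blk (m * n) c (l + address (P ^ m) e n)"
proof -
  define k where "k = 2 * nat \<bar>l\<bar>"
  have sp: "spread_digits (P ^ m) e" using self by (simp add: self_occurrences_def)
  have "\<bar>l\<bar> \<le> address (P ^ m) e k" "address (P ^ m) e k + \<bar>l\<bar> < (P ^ m) ^ k"
    using address_ge[OF sp, of "nat \<bar>l\<bar>" k] address_le[OF sp, of "nat \<bar>l\<bar>" k] by (auto simp: k_def)
  then have k: "0 \<le> l + address (P ^ m) e k" "l + address (P ^ m) e k < (P ^ m) ^ k" by linarith+
  have "nested_point m e c l = blk (m * k) c (l + address (P ^ m) e k)"
    by (simp add: nested_point_def k_def Let_def)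
  also have "\<dots> = blk (m * max k n) c (l + address (P ^ m) e (max k n))"
    using blk_address_extend[OF self _ k, of "max k n"] by simp
  also have "\<dots> = blk (m * n) c (l + address (P ^ m) e n)"
    using blk_address_extend[OF self _ assms(2,3), of "max k n"] by simp
  finally show ?thesis .
qed

lemma nested_point_admissible:
  assumes self: "self_occurrences m e c"
  shows "nested_point m e c \<in> admissible"
proof (rule admissibleI[of 0])
  fix N :: int assume N: "N \<ge> 0"
  have sp: "spread_digits (P ^ m) e" using self by (simp add: self_occurrences_def)
  define n where "n = 2 * nat N"
  have n: "N \<le> address (P ^ m) e n" "address (P ^ m) e n + N < (P ^ m) ^ n"
    using address_ge[OF sp, of "nat N" n] address_le[OF sp, of "nat N" n] N by (auto simp: n_def)
  show "\<exists>n a j. N \<le> j \<and> j + N < P ^ n \<and> (\<forall>l. \<bar>l\<bar> \<le> N \<longrightarrow> nested_point m e c l = blk n a (j + l))"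
  proof (intro exI conjI allI impI)
    fix l assume "\<bar>l\<bar> \<le> N"
    then have "0 \<le> l + address (P ^ m) e n" "l + address (P ^ m) e n < (P ^ m) ^ n" using n by linarith+
    from nested_point_eq[OF self this]
    show "nested_point m e c l = blk (m * n) c (address (P ^ m) e n + l)" by (simp add: add.commute)
  qed (use n in \<open>auto simp: power_mult\<close>)
qed

lemma nested_point_self_similar:
  assumes self: "self_occurrences m e c"
  shows "nested_point m e c = shift_iter (address (P ^ m) e (2 * k))
    (inflate (m * (2 * k)) (nested_point m (\<lambda>j. e (2 * k + j)) c))"
proof
  fix l
  define f where "f = (\<lambda>j. e (2 * k + j))"
  define A where "A = address (P ^ m) e (2 * k)"
  define R where "R = P ^ (m * (2 * k))"
  have R: "R = (P ^ m) ^ (2 * k)" by (simp add: R_def power_mult)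
  have sp: "spread_digits (P ^ m) e" "self_occurrences m f c"
    using self self_occurrences_shift by (auto simp: self_occurrences_def f_def)
  define n where "n = 2 * nat \<bar>l\<bar>"
  have "\<bar>l\<bar> \<le> address (P ^ m) e (2 * k + n)" "address (P ^ m) e (2 * k + n) + \<bar>l\<bar> < (P ^ m) ^ (2 * k + n)"
    using address_ge[OF sp(1), of "nat \<bar>l\<bar>" "2 * k + n"] address_le[OF sp(1), of "nat \<bar>l\<bar>" "2 * k + n"]
    by (auto simp: n_def)
  then have b: "0 \<le> l + address (P ^ m) e (2 * k + n)"
    "l + address (P ^ m) e (2 * k + n) < (P ^ m) ^ (2 * k + n)" by linarith+
  have ad: "address (P ^ m) e (2 * k + n) = A + address (P ^ m) f n * R"
    by (simp add: address_add A_def f_def R)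
  define s where "s = (l + A) div R + address (P ^ m) f n"
  have Rpos: "R > 0" unfolding R_def by (rule P_power_pos)
  have div: "(l + address (P ^ m) e (2 * k + n)) div R = s"
    using Rpos unfolding ad s_def by (metis add.assoc add.commute div_mult_self1 less_irrefl)
  have mod: "(l + address (P ^ m) e (2 * k + n)) mod R = (l + A) mod R"
    unfolding ad by (metis add.assoc mod_mult_self1)
  have s0: "0 \<le> s" unfolding div[symmetric] using b(1) Rpos pos_imp_zdiv_nonneg_iff by blast
  have "s * R \<le> l + address (P ^ m) e (2 * k + n)"
    unfolding div[symmetric] using Rpos
    by (metis add_increasing2 div_mult_mod_eq order_refl pos_mod_sign)
  also have "\<dots> < (P ^ m) ^ n * R" using b(2) by (simp add: R power_add mult.commute)
  finally have "s * R < (P ^ m) ^ n * R" .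
  then have s1: "s < (P ^ m) ^ n" using Rpos mult_right_less_imp_less by (metis less_imp_le)
  have "nested_point m e c l = blk (m * (2 * k + n)) c (l + address (P ^ m) e (2 * k + n))"
    by (rule nested_point_eq[OF self b])
  also have "\<dots> = blk (m * (2 * k) + m * n) c (l + address (P ^ m) e (2 * k + n))"
    by (simp only: distrib_left)
  also have "\<dots> = blk (m * (2 * k)) (blk (m * n) c s) ((l + A) mod R)"
  proof -
    have "P ^ (m * (2 * k) + m * n) = (P ^ m) ^ (2 * k + n)"
      by (simp only: distrib_left[symmetric] power_mult)
    then have "l + address (P ^ m) e (2 * k + n) < P ^ (m * (2 * k) + m * n)" using b(2) by simp
    from blk_add[OF b(1) this] show ?thesis by (simp only: R_def[symmetric] div mod)
  qed
  also have "blk (m * n) c s = nested_point m f c ((l + A) div R)"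
    using nested_point_eq[OF sp(2), of "(l + A) div R" n] s0 s1 by (simp add: s_def)
  finally show "nested_point m e c l = shift_iter (address (P ^ m) e (2 * k))
      (inflate (m * (2 * k)) (nested_point m (\<lambda>j. e (2 * k + j)) c)) l"
    by (simp only: shift_iter_def inflate_def A_def R_def f_def)
qed

text \<open>By recognizability the addresses can be read off from the point. Restricting to even levels keeps
  the tail of the digit sequence spread, so that the deflated point is again of the same kind.\<close>

lemma nested_point_determines_even_digits:
  assumes inf: "infinite admissible"
    and self: "self_occurrences m e c" "self_occurrences m f c'"
    and eq: "nested_point m e c = nested_point m f c'"
  shows "e (2 * k) = f (2 * k)"
proof -
  have ad: "address (P ^ m) e (2 * k) = address (P ^ m) f (2 * k)" for k
  proof (rule recognizability[OF inf])
    let ?e = "nested_point m (\<lambda>j. e (2 * k + j)) c" and ?f = "nested_point m (\<lambda>j. f (2 * k + j)) c'"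
    show "?e \<in> admissible" "?f \<in> admissible"
      using self by (intro nested_point_admissible self_occurrences_shift; simp)+
    show "shift_iter (address (P ^ m) e (2 * k)) (inflate (m * (2 * k)) ?e)
        = shift_iter (address (P ^ m) f (2 * k)) (inflate (m * (2 * k)) ?f)"
      using eq nested_point_self_similar self by metis
    have "0 \<le> address (P ^ m) g (2 * k) \<and> address (P ^ m) g (2 * k) < P ^ (m * (2 * k))"
      if "spread_digits (P ^ m) g" for g
      using address_ge[OF that, of 0 "2 * k"] address_le[OF that, of 0 "2 * k"] by (simp add: power_mult)
    then show "0 \<le> address (P ^ m) e (2 * k)" "address (P ^ m) e (2 * k) < P ^ (m * (2 * k))"
      "0 \<le> address (P ^ m) f (2 * k)" "address (P ^ m) f (2 * k) < P ^ (m * (2 * k))"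
      using self by (auto simp: self_occurrences_def)
  qed
  have "(e (2 * k) + e (Suc (2 * k)) * P ^ m) * (P ^ m) ^ (2 * k)
      = (f (2 * k) + f (Suc (2 * k)) * P ^ m) * (P ^ m) ^ (2 * k)"
    using ad[of k] ad[of "Suc k"] by (simp add: address_Suc algebra_simps)
  then have "e (2 * k) + e (Suc (2 * k)) * P ^ m = f (2 * k) + f (Suc (2 * k)) * P ^ m"
    using p_pos by auto
  then have "(e (2 * k) + e (Suc (2 * k)) * P ^ m) mod P ^ m = (f (2 * k) + f (Suc (2 * k)) * P ^ m) mod P ^ m"
    by simp
  moreover have "0 \<le> e (2 * k)" "e (2 * k) < P ^ m" "0 \<le> f (2 * k)" "f (2 * k) < P ^ m"
    using self spread_digitsD(1,2) unfolding self_occurrences_def by blast+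
  ultimately show ?thesis by simp
qed

section \<open>Uncountably many Li--Yorke pairs\<close>

text \<open>Each set \<open>B\<close> of numbers is encoded in the even digits; every odd digit is the opposite of the digit before
  it, so that \<open>s\<close> and \<open>t\<close> both recur whatever \<open>B\<close> is. Seen from a level with digit
  \<open>s\<close>, the position \<open>t\<close> is a place of disagreement to the right of the origin and the whole block at
  position \<open>r\<close> is a place of agreement.\<close>

lemma uncountable_li_yorke_pairs:
  assumes inf: "infinite admissible" and comp: "compatible_metric admissible d" and sub: "subshift admissible"
    and ab: "a \<noteq> b" and st: "0 \<le> s" "s < t" "t < P ^ m" and r: "s < r" "r < P ^ m"
    and occ: "blk m a s = a" "blk m a t = a" "blk m b s = b" "blk m b t = b"
    and coin: "blk m a r = blk m b r"
  shows "uncountable (li_yorke_pairs admissible d)"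
proof -
  define e where "e B n = (if (n div 2 \<in> B) = even n then s else t)" for B :: "nat set" and n :: nat
  have e_even: "e B (2 * k) = (if k \<in> B then s else t)" and
    e_odd: "e B (Suc (2 * k)) = (if k \<in> B then t else s)" for B k
    by (auto simp: e_def)
  have "spread_digits (P ^ m) (e B)" for B
    unfolding spread_digits_def e_even e_odd using st by (auto simp: e_def)
  then have self: "self_occurrences m (e B) a" "self_occurrences m (e B) b" for B
    using occ by (auto simp: self_occurrences_def e_def)
  have value_at: "nested_point m (e B) c (q - address (P ^ m) (e B) n + (i - s) * (P ^ m) ^ n) = blk (m * n) (blk m c i) q"
    if "e B n = s" "self_occurrences m (e B) c" "0 \<le> q" "q < (P ^ m) ^ n" "0 \<le> i" "i < P ^ m" for B c q n i
  proof -
    let ?l = "q - address (P ^ m) (e B) n + (i - s) * (P ^ m) ^ n"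
    have eq: "?l + address (P ^ m) (e B) (Suc n) = q + i * (P ^ m) ^ n"
      using that(1) by (simp add: address_Suc algebra_simps)
    have *: "q + i * (P ^ m) ^ n < (P ^ m) ^ Suc n"
      "blk (m * Suc n) c (q + i * (P ^ m) ^ n) = blk (m * n) (blk m c i) q"
      using blk_address_mult(1)[of "q - address (P ^ m) (e B) n" m "e B" n i c]
        blk_address_mult(2)[of "q - address (P ^ m) (e B) n" m "e B" n i] that by auto
    have "0 \<le> q + i * (P ^ m) ^ n" using that by simp
    then show ?thesis using nested_point_eq[OF that(2), of ?l "Suc n"] * unfolding eq by simp
  qed
  \<comment> \<open>The letter at the origin is \<open>c\<close> itself: extend the block of level \<open>0\<close>.\<close>
  have address_letter: "blk (m * n) c (address (P ^ m) (e B) n) = c" if "self_occurrences m (e B) c" for B c n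
    using blk_address_extend[OF that, of 0 n 0] by simp
  have LY: "li_yorke d (nested_point m (e B) a) (nested_point m (e B) b)" for B
  proof -
    let ?x = "nested_point m (e B) a" and ?y = "nested_point m (e B) b"
    have sp: "spread_digits (P ^ m) (e B)" using self by (simp add: self_occurrences_def)
    have often: "\<exists>n. 2 * k \<le> n \<and> e B n = s" for k
      by (cases "k \<in> B") (use e_even e_odd in \<open>force intro: exI[of _ "2 * k"] exI[of _ "Suc (2 * k)"]\<close>)+
    have grow: "int k \<le> j * (P ^ m) ^ n" if "2 * k \<le> n" "1 \<le> j" for k n j
    proof -
      have "int k \<le> address (P ^ m) (e B) n" "address (P ^ m) (e B) n < (P ^ m) ^ n"
        using address_ge[OF sp that(1)] address_le[OF sp, of 0 n] by auto
      moreover have "1 * (P ^ m) ^ n \<le> j * (P ^ m) ^ n" using that by (intro mult_right_mono) auto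
      ultimately show ?thesis by linarith
    qed
    have "\<exists>l\<ge>C. ?x l \<noteq> ?y l" for C
    proof -
      obtain n where n: "2 * nat C \<le> n" "e B n = s" using often by blast
      have "int (nat C) \<le> (t - s) * (P ^ m) ^ n" using n st by (intro grow) auto
      then have "C \<le> (t - s) * (P ^ m) ^ n" by linarith
      moreover have "nested_point m (e B) c ((t - s) * (P ^ m) ^ n) = c"
        if "self_occurrences m (e B) c" "blk m c t = c" for c
        using value_at[OF n(2) that(1), of "address (P ^ m) (e B) n" t] address_letter[OF that(1), of n]
          address_ge[OF sp, of 0 n] address_le[OF sp, of 0 n] st that(2) by simp
      ultimately show ?thesis using self occ ab by metis
    qed
    moreover have "\<exists>l\<ge>C. \<forall>l'. l \<le> l' \<and> l' \<le> l + N \<longrightarrow> ?x l' = ?y l'" for N C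
    proof -
      define k where "k = nat (max C N)"
      obtain n where n: "2 * k \<le> n" "e B n = s" using often by blast
      have "int k \<le> (r - s) * (P ^ m) ^ n" using n r by (intro grow) auto
      moreover have "C \<le> int k" unfolding k_def by linarith
      ultimately have 1: "C \<le> (r - s) * (P ^ m) ^ n" by linarith
      have 2: "?x l = ?y l" if "(r - s) * (P ^ m) ^ n \<le> l" "l \<le> (r - s) * (P ^ m) ^ n + N" for l
      proof -
        define q where "q = l - (r - s) * (P ^ m) ^ n + address (P ^ m) (e B) n"
        have "N \<le> int k" unfolding k_def by linarith
        then have "0 \<le> q" "q < (P ^ m) ^ n"
          using that address_ge[OF sp, of 0 n] address_le[OF sp n(1)] by (auto simp: q_def)
        moreover have "l = q - address (P ^ m) (e B) n + (r - s) * (P ^ m) ^ n" by (simp add: q_def)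
        ultimately show ?thesis using value_at[OF n(2)] self coin r st by simp
      qed
      show ?thesis using 1 2 by blast
    qed
    ultimately show ?thesis
      using li_yorke_iff[OF comp sub] nested_point_admissible self by blast
  qed
  define \<phi> where "\<phi> B = {nested_point m (e B) a, nested_point m (e B) b}" for B
  have "inj \<phi>"
  proof (rule injI)
    fix B C assume "\<phi> B = \<phi> C"
    then have "nested_point m (e B) a = nested_point m (e C) a \<or> nested_point m (e B) a = nested_point m (e C) b"
      by (auto simp: \<phi>_def)
    then have "e B (2 * k) = e C (2 * k)" for k
      using nested_point_determines_even_digits[OF inf] self by blast
    then have "k \<in> B \<longleftrightarrow> k \<in> C" for k
      using st(2) unfolding e_even by (metis less_irrefl)
    then show "B = C" by blast
  qed
  then have "uncountable (range \<phi>)"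
    using uncountable_nat_sets by (simp add: countable_image_inj_eq)
  moreover have "range \<phi> \<subseteq> li_yorke_pairs admissible d"
  proof (rule image_subsetI)
    fix B
    show "\<phi> B \<in> li_yorke_pairs admissible d"
      unfolding \<phi>_def li_yorke_pairs_def mem_Collect_eq
      using nested_point_admissible[OF self(1)] nested_point_admissible[OF self(2)] LY
      by (intro exI[of _ "nested_point m (e B) a"] exI[of _ "nested_point m (e B) b"] conjI refl)
  qed
  ultimately show ?thesis using countable_subset by blast
qed

end

section \<open>Proximal pairs and their common parsing\<close>

lemma address_bounds:
  assumes "\<And>j. 0 \<le> e j \<and> e j < Q"
  shows "0 \<le> address Q e n \<and> address Q e n < Q ^ n"
proof (induction n)
  case (Suc n)
  have "Q > 0" using assms[of 0] by linarith
  then have "0 \<le> e n * Q ^ n" using assms[of n] by simp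
  moreover have "(e n + 1) * Q ^ n \<le> Q * Q ^ n"
    using assms[of n] \<open>Q > 0\<close> by (intro mult_right_mono) auto
  then have "e n * Q ^ n + Q ^ n \<le> Q ^ Suc n" by (simp add: distrib_right)
  ultimately show ?case using Suc unfolding address_Suc by linarith
qed simp

lemma address_unbounded:
  assumes e: "\<And>j. 0 \<le> e j \<and> e j < Q" and inf: "\<And>n. \<exists>j\<ge>n. e j \<noteq> 0"
  shows "\<exists>j0. \<forall>j\<ge>j0. L \<le> address Q e j"
proof -
  have "\<exists>j. int k \<le> address Q e j" for k
  proof (induction k)
    case (Suc k)
    then obtain j where j: "int k \<le> address Q e j" by blast
    obtain j' where j': "j' \<ge> j" "e j' \<noteq> 0" using inf by blast
    have "Q > 0" "e j' \<ge> 1" using e[of j'] j'(2) by linarith+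
    then have "1 * 1 \<le> e j' * Q ^ j'" by (intro mult_mono one_le_power) auto
    then have "int (Suc k) \<le> address Q e (Suc j')"
      using j address_mono[of e Q, OF e j'(1)] by (simp add: address_Suc)
    then show ?case by blast
  qed (auto intro: exI[of _ 0])
  then obtain j0 where "int (nat L) \<le> address Q e j0" by blast
  then have "\<forall>j\<ge>j0. L \<le> address Q e j" using address_mono[of e Q, OF e] by (smt (verit) nat_0_le int_nat_eq)
  then show ?thesis by blast
qed

lemma address_codominated:
  assumes e: "\<And>j. 0 \<le> e j \<and> e j < Q" and inf: "\<And>n. \<exists>j\<ge>n. e j \<noteq> Q - 1"
  shows "\<exists>j0. \<forall>j\<ge>j0. L + address Q e j < Q ^ j"
proof -
  have "\<exists>j0. \<forall>j\<ge>j0. L \<le> address Q (\<lambda>j. Q - 1 - e j) j"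
  proof (rule address_unbounded)
    show "0 \<le> Q - 1 - e j \<and> Q - 1 - e j < Q" for j using e[of j] by linarith
    show "\<exists>j\<ge>n. Q - 1 - e j \<noteq> 0" for n using inf[of n] by auto
  qed
  then obtain j0 where "\<And>j. j \<ge> j0 \<Longrightarrow> L \<le> Q ^ j - 1 - address Q e j"
    unfolding address_complement by blast
  then have "L + address Q e j < Q ^ j" if "j \<ge> j0" for j using that by fastforce
  then show ?thesis by blast
qed

definition proximal_right :: "(int \<Rightarrow> 'a) \<Rightarrow> (int \<Rightarrow> 'a) \<Rightarrow> bool" where
  "proximal_right x y \<longleftrightarrow> (\<forall>N. \<exists>s\<ge>0. \<forall>l. s \<le> l \<and> l \<le> s + N \<longrightarrow> x l = y l)"

locale aperiodic_subst = primitive_subst_constant_length +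
  assumes inj: "inj \<tau>" and infinite: "infinite admissible"
begin

lemma inflate_mult: "0 \<le> q \<Longrightarrow> q < P ^ n \<Longrightarrow> inflate n x (l * P ^ n + q) = blk n (x l) q"
  by (simp add: inflate_def)

lemma blk_1_inj:
  assumes "\<And>q. 0 \<le> q \<Longrightarrow> q < P \<Longrightarrow> blk 1 a q = blk 1 b q"
  shows "a = b"
proof -
  have 1: "subst_pow \<tau> 1 c = \<tau> c" for c by (simp add: subst_pow_def subst_word_def)
  have len: "length (\<tau> c) = p" for c using const_len by (simp add: constant_length_def)
  have "\<tau> a = \<tau> b"
  proof (rule nth_equalityI)
    fix i assume "i < length (\<tau> a)"
    then show "\<tau> a ! i = \<tau> b ! i" using assms[of "int i"] unfolding blk_def 1 by (simp add: len)
  qed (simp add: len)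
  then show ?thesis using inj by (simp add: inj_eq)
qed

text \<open>Agreement on ever longer windows produces, in the limit, a point parsed in both ways.\<close>

lemma proximal_common_offset:
  assumes x: "x' \<in> admissible" "0 \<le> i" "i < P" and y: "y' \<in> admissible" "0 \<le> j" "j < P"
    and prox: "proximal_right (shift_iter i (inflate 1 x')) (shift_iter j (inflate 1 y'))"
  shows "i = j"
proof -
  let ?x = "shift_iter i (inflate 1 x')" and ?y = "shift_iter j (inflate 1 y')"
  have Ppos: "P > 0" by simp
  \<comment> \<open>Windows centred at multiples of \<open>p\<close>, where the offsets \<open>i\<close> and \<open>j\<close> remain visible; the extra length \<open>P\<close>
    leaves room to reach the next multiple.\<close>
  have "\<exists>t. \<forall>l. \<bar>l\<bar> \<le> int N \<longrightarrow> ?x (P * t + l) = ?y (P * t + l)" for N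
  proof -
    obtain s where s: "s \<ge> 0" "\<And>l. s \<le> l \<and> l \<le> s + (2 * int N + P) \<Longrightarrow> ?x l = ?y l"
      using prox unfolding proximal_right_def by blast
    define t where "t = (s + int N) div P + 1"
    have "(s + int N) div P * P + (s + int N) mod P = s + int N" by (simp only: div_mult_mod_eq)
    moreover have "0 \<le> (s + int N) mod P" "(s + int N) mod P < P" using Ppos by simp_all
    ultimately have "s + int N < (s + int N) div P * P + P" "(s + int N) div P * P \<le> s + int N" by linarith+
    then have t: "s + int N < P * t" "P * t \<le> s + int N + P"
      unfolding t_def by (simp_all add: algebra_simps)
    show ?thesis
    proof (intro exI[of _ t] allI impI s(2))
      fix l assume "\<bar>l\<bar> \<le> int N"
      then show "s \<le> P * t + l \<and> P * t + l \<le> s + (2 * int N + P)" using t by linarith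
    qed
  qed
  then obtain t where t: "\<And>N l. \<bar>l\<bar> \<le> int N \<Longrightarrow> ?x (P * t N + l) = ?y (P * t N + l)" by metis
  obtain r :: "nat \<Rightarrow> nat" and u where r: "strict_mono r"
    "\<And>M. \<exists>K. \<forall>k\<ge>K. \<forall>l. \<bar>l\<bar> \<le> M \<longrightarrow> shift_iter (t (r k)) x' l = u l"
    using pointwise_convergent_subsequence[of "\<lambda>N. shift_iter (t N) x'"] by blast
  obtain r' :: "nat \<Rightarrow> nat" and v where r': "strict_mono r'"
    "\<And>M. \<exists>K. \<forall>k\<ge>K. \<forall>l. \<bar>l\<bar> \<le> M \<longrightarrow> shift_iter (t (r (r' k))) y' l = v l"
    using pointwise_convergent_subsequence[of "\<lambda>k. shift_iter (t (r k)) y'"] by blast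
  have common: "\<exists>N. int N \<ge> M \<and> (\<forall>l. \<bar>l\<bar> \<le> M \<longrightarrow> shift_iter (t N) x' l = u l \<and> shift_iter (t N) y' l = v l)" for M
  proof -
    obtain K where K: "\<And>k l. k \<ge> K \<Longrightarrow> \<bar>l\<bar> \<le> M \<Longrightarrow> shift_iter (t (r k)) x' l = u l" using r(2) by blast
    obtain K' where K': "\<And>k l. k \<ge> K' \<Longrightarrow> \<bar>l\<bar> \<le> M \<Longrightarrow> shift_iter (t (r (r' k))) y' l = v l" using r'(2) by blast
    define k where "k = Max {K, K', nat M}"
    have k: "k \<ge> K" "k \<ge> K'" "k \<ge> nat M" by (auto simp: k_def)
    have "r' k \<ge> k" "r (r' k) \<ge> r' k" using seq_suble r(1) r'(1) by blast+
    then show ?thesis using K[of "r' k"] K'[of k] k by (intro exI[of _ "r (r' k)"]) auto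
  qed
  have "u \<in> admissible" "v \<in> admissible"
    using common admissible_shift[OF x(1)] admissible_shift[OF y(1)]
    by (intro admissible_closed, metis)+
  moreover have "shift_iter i (inflate 1 u) = shift_iter j (inflate 1 v)"
  proof
    fix l
    define M where "M = Max {\<bar>l\<bar>, \<bar>(l + i) div P\<bar>, \<bar>(l + j) div P\<bar>}"
    have M: "\<bar>l\<bar> \<le> M" "\<bar>(l + i) div P\<bar> \<le> M" "\<bar>(l + j) div P\<bar> \<le> M" by (auto simp: M_def)
    obtain N where N: "int N \<ge> M" "\<And>l. \<bar>l\<bar> \<le> M \<Longrightarrow> shift_iter (t N) x' l = u l"
      "\<And>l. \<bar>l\<bar> \<le> M \<Longrightarrow> shift_iter (t N) y' l = v l"
      using common by blast
    have "shift_iter i (inflate 1 u) l = inflate 1 (shift_iter (t N) x') (l + i)"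
      using N(2)[OF M(2)] by (simp add: shift_iter_def[of i] inflate_def)
    also have "\<dots> = ?x (P * t N + l)"
      unfolding inflate_shift by (simp add: shift_iter_def algebra_simps)
    also have "\<dots> = ?y (P * t N + l)" using t[of l N] M N(1) by linarith
    also have "\<dots> = inflate 1 (shift_iter (t N) y') (l + j)"
      unfolding inflate_shift by (simp add: shift_iter_def algebra_simps)
    also have "\<dots> = shift_iter j (inflate 1 v) l"
      using N(3)[OF M(3)] by (simp add: shift_iter_def[of j] inflate_def)
    finally show "shift_iter i (inflate 1 u) l = shift_iter j (inflate 1 v) l" .
  qed
  ultimately show ?thesis using recognizability[OF infinite, of u v i 1 j] x y by simp
qed

lemma proximal_right_deflate:
  assumes i: "0 \<le> i" "i < P"
    and prox: "proximal_right (shift_iter i (inflate 1 x)) (shift_iter i (inflate 1 y))"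
  shows "proximal_right x y"
  unfolding proximal_right_def
proof
  fix N :: int
  define M where "M = max N 0"
  obtain s where s: "s \<ge> 0" "\<And>l. s \<le> l \<and> l \<le> s + P * (M + 2) \<Longrightarrow>
      shift_iter i (inflate 1 x) l = shift_iter i (inflate 1 y) l"
    using prox unfolding proximal_right_def by blast
  define l0 where "l0 = (s + i) div P + 1"
  have Ppos: "P > 0" by simp
  have "(s + i) div P * P + (s + i) mod P = s + i" by (simp only: div_mult_mod_eq)
  moreover have "0 \<le> (s + i) mod P" "(s + i) mod P < P" using Ppos by simp_all
  ultimately have "s + i < (s + i) div P * P + P" "(s + i) div P * P \<le> s + i" by linarith+
  then have l0: "s + i < P * l0" "P * l0 \<le> s + i + P"
    unfolding l0_def by (simp_all add: algebra_simps)
  have "(s + i) div P \<ge> 0" using s(1) i Ppos pos_imp_zdiv_nonneg_iff[OF Ppos, of "s + i"] by linarith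
  then have "l0 \<ge> 0" by (simp add: l0_def)
  moreover have "x l = y l" if l: "l0 \<le> l" "l \<le> l0 + N" for l
  proof (rule blk_1_inj)
    fix q assume q: "0 \<le> q" "q < P"
    have "P * l0 \<le> P * l" "P * l \<le> P * (l0 + M)" using l by (auto intro!: mult_left_mono simp: M_def)
    then have "s \<le> l * P + q - i \<and> l * P + q - i \<le> s + P * (M + 2)"
    proof -
      have "P * (l0 + M) = P * l0 + P * M" by (rule distrib_left)
      with \<open>P * l \<le> P * (l0 + M)\<close> have "P * l \<le> P * l0 + P * M" by (rule ord_le_eq_trans)
      moreover have "P * (M + 2) = P * M + P + P" by (simp add: distrib_left)
      moreover have "l * P = P * l" by (rule mult.commute)
      ultimately show ?thesis using \<open>P * l0 \<le> P * l\<close> l0 q i by presburger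
    qed
    from s(2)[OF this] have "inflate 1 x (l * P ^ 1 + q) = inflate 1 y (l * P ^ 1 + q)"
      by (simp add: shift_iter_def)
    then show "blk 1 (x l) q = blk 1 (y l) q" using inflate_mult[of q 1] q by simp
  qed
  ultimately show "\<exists>s\<ge>0. \<forall>l. s \<le> l \<and> l \<le> s + N \<longrightarrow> x l = y l" by blast
qed

text \<open>An infinite sequence of desubstitutions: \<open>x n\<close> is the point of level \<open>n\<close> and \<open>i n\<close> its offset.\<close>

definition parsing :: "(nat \<Rightarrow> int \<Rightarrow> 'a) \<Rightarrow> (nat \<Rightarrow> int) \<Rightarrow> bool" where
  "parsing x i \<longleftrightarrow> (\<forall>n. (0 \<le> i n \<and> i n < P) \<and> x n = shift_iter (i n) (inflate 1 (x (Suc n))))"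

text \<open>Proximality is inherited by the desubstituted pair, so the common offset exists on every level.\<close>

lemma proximal_common_parsing:
  assumes "x0 \<in> admissible" "y0 \<in> admissible" "proximal_right x0 y0"
  obtains x y i where "x 0 = x0" "y 0 = y0" "parsing x i" "parsing y i"
    "\<And>n. proximal_right (x n) (y n)"
proof -
  define Pr where "Pr n s \<longleftrightarrow> fst s \<in> admissible \<and> snd s \<in> admissible \<and> proximal_right (fst s) (snd s)
      \<and> (n = 0 \<longrightarrow> s = (x0, y0))" for n :: nat and s
  define St where "St s s' \<longleftrightarrow> (\<exists>i. (0 \<le> i \<and> i < P) \<and> fst s = shift_iter i (inflate 1 (fst s'))
      \<and> snd s = shift_iter i (inflate 1 (snd s')))" for s s'
  have "\<exists>f. \<forall>n. Pr n (f n) \<and> St (f n) (f (Suc n))"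
  proof (rule dependent_nat_choice)
    show "\<exists>s. Pr 0 s" using assms by (auto simp: Pr_def)
    fix s n assume s: "Pr n s"
    obtain i x' where x': "0 \<le> i" "i < P ^ 1" "x' \<in> admissible" "fst s = shift_iter i (inflate 1 x')"
      using admissible_desubstitute s unfolding Pr_def by metis
    obtain j y' where y': "0 \<le> j" "j < P ^ 1" "y' \<in> admissible" "snd s = shift_iter j (inflate 1 y')"
      using admissible_desubstitute s unfolding Pr_def by metis
    have prox: "proximal_right (shift_iter i (inflate 1 x')) (shift_iter j (inflate 1 y'))"
      using s x' y' by (simp add: Pr_def)
    then have "i = j" using proximal_common_offset x' y' by simp
    then have "proximal_right x' y'" using proximal_right_deflate[of j x' y'] prox y' by simp
    then show "\<exists>s'. Pr (Suc n) s' \<and> St s s'"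
      using x' y' \<open>i = j\<close> by (intro exI[of _ "(x', y')"]) (auto simp: Pr_def St_def)
  qed
  then obtain f where f: "\<And>n. Pr n (f n)" "\<And>n. St (f n) (f (Suc n))" by blast
  then obtain i where i: "\<And>n. (0 \<le> i n \<and> i n < P) \<and> fst (f n) = shift_iter (i n) (inflate 1 (fst (f (Suc n))))
      \<and> snd (f n) = shift_iter (i n) (inflate 1 (snd (f (Suc n))))"
    unfolding St_def by metis
  show ?thesis
  proof (rule that)
    show "fst (f 0) = x0" "snd (f 0) = y0" using f(1)[of 0] by (auto simp: Pr_def)
    show "parsing (\<lambda>n. fst (f n)) i" "parsing (\<lambda>n. snd (f n)) i" unfolding parsing_def using i by blast+
    show "proximal_right (fst (f n)) (snd (f n))" for n using f(1) by (simp add: Pr_def)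
  qed
qed

abbreviation offset :: "(nat \<Rightarrow> int) \<Rightarrow> nat \<Rightarrow> nat \<Rightarrow> int" where
  "offset i n j \<equiv> address P (\<lambda>t. i (n + t)) j"

lemma parsing_digits: "parsing x i \<Longrightarrow> 0 \<le> i n \<and> i n < P"
  unfolding parsing_def by blast

lemma parsing_step: "parsing x i \<Longrightarrow> x n = shift_iter (i n) (inflate 1 (x (Suc n)))"
  unfolding parsing_def by blast

lemma offset_bounds:
  assumes "parsing x i"
  shows "0 \<le> offset i n j" "offset i n j < P ^ j"
proof -
  have "0 \<le> offset i n j \<and> offset i n j < P ^ j"
    by (rule address_bounds) (rule parsing_digits[OF assms])
  then show "0 \<le> offset i n j" "offset i n j < P ^ j" by (rule conjunct1, rule conjunct2)
qed

lemma parsing_iterate: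
  assumes "parsing x i"
  shows "x n = shift_iter (offset i n j) (inflate j (x (n + j)))"
proof (induction j)
  case (Suc j)
  have "x (n + j) = shift_iter (i (n + j)) (inflate 1 (x (n + Suc j)))"
    using parsing_step[OF assms, of "n + j"] by (simp only: add_Suc_right)
  then have "inflate j (x (n + j)) = shift_iter (i (n + j) * P ^ j) (inflate (Suc j) (x (n + Suc j)))"
    using inflate_add[of j 1] by (simp add: inflate_shift)
  then show ?case using Suc by (simp add: address_Suc)
qed simp

lemma parsing_letter:
  assumes "parsing x i" "0 \<le> l + offset i n j" "l + offset i n j < P ^ j"
  shows "x n l = blk j (x (n + j) 0) (l + offset i n j)"
proof -
  have "x n l = inflate j (x (n + j)) (0 * P ^ j + (l + offset i n j))"
    by (subst parsing_iterate[OF assms(1), of n j]) (simp add: shift_iter_def)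
  then show ?thesis using inflate_mult[of "l + offset i n j" j "x (n + j)" 0] assms by simp
qed

text \<open>A point is determined by the offsets and by three consecutive letters around the origin at
  infinitely many levels: three blocks of level \<open>j\<close> cover all coordinates up to \<open>P ^ j\<close>.\<close>

lemma parsing_determined:
  assumes "parsing x i" "parsing y k"
    and inf: "infinite {j. offset i n j = offset k n j \<and> (\<forall>c\<in>{-1, 0, 1}. x (n + j) c = y (n + j) c)}"
  shows "x n = y n"
proof
  fix l
  obtain j where j: "j \<ge> nat \<bar>l\<bar>" "offset i n j = offset k n j" "\<forall>c\<in>{-1, 0, 1}. x (n + j) c = y (n + j) c"
    using inf unfolding infinite_nat_iff_unbounded_le by blast
  define b where "b = (l + offset i n j) div P ^ j"
  have "\<bar>l\<bar> < P ^ j" using P_power_ge[of j] j(1) by linarith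
  then have "- 1 * P ^ j \<le> l + offset i n j" "l + offset i n j < 2 * P ^ j"
    using offset_bounds[OF assms(1), of n j] by linarith+
  moreover have "l + offset i n j = b * P ^ j + (l + offset i n j) mod P ^ j" "0 \<le> (l + offset i n j) mod P ^ j"
    "(l + offset i n j) mod P ^ j < P ^ j"
    unfolding b_def by (simp_all only: div_mult_mod_eq pos_mod_sign[OF P_power_pos] pos_mod_bound[OF P_power_pos])
  ultimately have "b * P ^ j < 2 * P ^ j" "- 2 * P ^ j < b * P ^ j" by linarith+
  then have "b < 2" "- 2 < b" using mult_right_less_imp_less P_power_pos by (metis less_imp_le)+
  then have "b = -1 \<or> b = 0 \<or> b = 1" by linarith
  then have "x (n + j) b = y (n + j) b" using j(3) by auto
  moreover have "x n l = blk j (x (n + j) b) ((l + offset i n j) mod P ^ j)"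
    by (subst parsing_iterate[OF assms(1), of n j]) (simp add: shift_iter_def inflate_def b_def)
  moreover have "y n l = blk j (y (n + j) b) ((l + offset i n j) mod P ^ j)"
    by (subst parsing_iterate[OF assms(2), of n j]) (simp add: shift_iter_def inflate_def b_def j(2))
  ultimately show "x n l = y n l" by simp
qed

end

section \<open>Finitely many Li--Yorke orbits in the absence of recurrence\<close>

text \<open>Among more elements than colours, two share their colour at every \<open>n\<close>; with finitely many pairs
  to choose from, one pair does so infinitely often.\<close>

lemma finite_if_colourings_separate:
  fixes c :: "'s \<Rightarrow> nat \<Rightarrow> 'c::finite"
  assumes sep: "\<And>u v. u \<in> S \<Longrightarrow> v \<in> S \<Longrightarrow> infinite {n. c u n = c v n} \<Longrightarrow> u = v"
  shows "finite S"
proof (rule ccontr)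
  assume "infinite S"
  then obtain F where F: "finite F" "card F = Suc CARD('c)" "F \<subseteq> S"
    using infinite_arbitrarily_large by blast
  have "\<exists>uv\<in>{uv \<in> F \<times> F. fst uv \<noteq> snd uv}. c (fst uv) n = c (snd uv) n" for n
  proof -
    have "card ((\<lambda>u. c u n) ` F) < card F"
      using card_mono[of UNIV "(\<lambda>u. c u n) ` F"] F(2) by simp
    then have "\<not> inj_on (\<lambda>u. c u n) F" by (rule pigeonhole)
    then show ?thesis unfolding inj_on_def by force
  qed
  then have "\<exists>uv\<in>{uv \<in> F \<times> F. fst uv \<noteq> snd uv}. infinite {n \<in> UNIV. c (fst uv) n = c (snd uv) n}"
    using F(1) by (intro pigeonhole_infinite_rel) auto
  then obtain u v where "u \<in> F" "v \<in> F" "u \<noteq> v" "infinite {n. c u n = c v n}" by auto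
  then show False using sep F(3) by blast
qed

lemma pair_orbit_shift: "pair_orbit (shift_iter k x) (shift_iter k y) = pair_orbit x y"
proof -
  have "{(shift_iter (n + k) x, shift_iter (n + k) y) | n. True} = {(shift_iter n x, shift_iter n y) | n. True}"
    by (auto, metis diff_add_cancel)
  then show ?thesis by (simp add: pair_orbit_def)
qed

context primitive_subst_constant_length
begin

text \<open>The condition of the theorem in terms of positions: \<open>s\<close> and \<open>t\<close> are the two occurrences and \<open>r\<close> is
  the place of the coincidence.\<close>

definition double_recurrence :: bool where
  "double_recurrence \<longleftrightarrow> (\<exists>m a b s t r. a \<noteq> b \<and> 0 \<le> s \<and> s < t \<and> t < P ^ m \<and> s < r \<and> r < P ^ m \<and>
     blk m a s = a \<and> blk m a t = a \<and> blk m b s = b \<and> blk m b t = b \<and> blk m a r = blk m b r)"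

end

context aperiodic_subst
begin

text \<open>Of the Li--Yorke property of a pair only two traces are kept: the points differ, and on every level they agree
  somewhere to the right of the origin. The second one yields the coincidence.\<close>

definition good_parsing :: "(nat \<Rightarrow> int \<Rightarrow> 'a) \<Rightarrow> (nat \<Rightarrow> int \<Rightarrow> 'a) \<Rightarrow> (nat \<Rightarrow> int) \<Rightarrow> bool" where
  "good_parsing x y i \<longleftrightarrow> parsing x i \<and> parsing y i \<and> x 0 \<noteq> y 0 \<and> (\<forall>n. \<exists>l>0. x n l = y n l)"

lemma good_parsing_orbit_eq:
  assumes "good_parsing x y i" "good_parsing x' y' i'" "x n = x' n" "y n = y' n"
  shows "pair_orbit (x 0) (y 0) = pair_orbit (x' 0) (y' 0)"
proof -
  have "pair_orbit (x 0) (y 0) = pair_orbit (inflate n (x n)) (inflate n (y n))"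
    if "good_parsing x y i" for x y i
  proof -
    have "x 0 = shift_iter (offset i 0 n) (inflate n (x n))" "y 0 = shift_iter (offset i 0 n) (inflate n (y n))"
      using that parsing_iterate[of _ i 0 n] unfolding good_parsing_def by simp_all
    then show ?thesis by (simp only: pair_orbit_shift)
  qed
  then show ?thesis using assms by metis
qed

text \<open>Let two pairs show \<open>(a, b)\<close> at the origin on level \<open>n\<close> and again on level \<open>n + j\<close>. Their offsets are two
  occurrences of \<open>(a, b)\<close> in its own block of level \<open>j\<close>. For large \<open>j\<close> this block is long enough to contain
  also an agreement to the right of the smaller offset, so the offsets cannot be different. The
  block grows to the right because the digits are not eventually maximal.\<close>

lemma good_parsing_same_offset:
  assumes no: "\<not> double_recurrence"
    and g: "good_parsing x y i" and g': "good_parsing x' y' i'"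
    and ab: "a \<noteq> b" "x n 0 = a" "y n 0 = b" "x' n 0 = a" "y' n 0 = b"
    and codom: "\<And>n. \<exists>k\<ge>n. i k \<noteq> P - 1" "\<And>n. \<exists>k\<ge>n. i' k \<noteq> P - 1"
  shows "\<exists>j0. \<forall>j\<ge>j0. x (n + j) 0 = a \<and> y (n + j) 0 = b \<and> x' (n + j) 0 = a \<and> y' (n + j) 0 = b
    \<longrightarrow> offset i n j = offset i' n j"
proof -
  have cover: "\<exists>j0. \<forall>j\<ge>j0. L + offset i n j < P ^ j" if px: "parsing x i" and cod: "\<And>n. \<exists>k\<ge>n. i k \<noteq> P - 1" for x i L
  proof (rule address_codominated)
    show "0 \<le> i (n + j) \<and> i (n + j) < P" for j using parsing_digits[OF px] .
    fix m
    obtain k where "k \<ge> n + m" "i k \<noteq> P - 1" using cod by blast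
    then show "\<exists>j\<ge>m. i (n + j) \<noteq> P - 1" by (intro exI[of _ "k - n"]) auto
  qed
  obtain l where l: "l > 0" "x n l = y n l" using g by (auto simp: good_parsing_def)
  obtain l' where l': "l' > 0" "x' n l' = y' n l'" using g' by (auto simp: good_parsing_def)
  obtain j1 where j1: "\<And>j. j \<ge> j1 \<Longrightarrow> l + offset i n j < P ^ j"
    using cover[of x i l] g codom(1) unfolding good_parsing_def by blast
  obtain j2 where j2: "\<And>j. j \<ge> j2 \<Longrightarrow> l' + offset i' n j < P ^ j"
    using cover[of x' i' l'] g' codom(2) unfolding good_parsing_def by blast
  have once: "\<not> offset i n j < offset i' n j"
    if "good_parsing x y i" "good_parsing x' y' i'" "x n 0 = a" "y n 0 = b" "x' n 0 = a" "y' n 0 = b"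
      and "l > 0" "x n l = y n l" "l + offset i n j < P ^ j"
      and "x (n + j) 0 = a" "y (n + j) 0 = b" "x' (n + j) 0 = a" "y' (n + j) 0 = b"
    for x y i x' y' i' l j
  proof
    assume less: "offset i n j < offset i' n j"
    note letter = parsing_letter[of x i _ n j] parsing_letter[of y i _ n j]
      parsing_letter[of x' i' _ n j] parsing_letter[of y' i' _ n j]
    have p: "parsing x i" "parsing y i" "parsing x' i'" "parsing y' i'"
      using that(1,2) by (auto simp: good_parsing_def)
    note b = offset_bounds[OF p(1), of n j] offset_bounds[OF p(3), of n j]
    have "blk j a (offset i n j) = a" "blk j b (offset i n j) = b"
      "blk j a (offset i' n j) = a" "blk j b (offset i' n j) = b"
      using letter[of 0] p b that by simp_all
    moreover have "blk j a (l + offset i n j) = blk j b (l + offset i n j)"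
      using letter(1,2)[of l] p b that by simp
    moreover have "offset i n j < l + offset i n j" using that by simp
    ultimately have double_recurrence
      unfolding double_recurrence_def using ab(1) b less that(9) by blast
    then show False using no by contradiction
  qed
  show ?thesis
  proof (intro exI[of _ "max j1 j2"] allI impI, elim conjE)
    fix j assume j: "max j1 j2 \<le> j"
      and c: "x (n + j) 0 = a" "y (n + j) 0 = b" "x' (n + j) 0 = a" "y' (n + j) 0 = b"
    have "\<not> offset i n j < offset i' n j" by (rule once[OF g g' ab(2-5) l j1 c]) (use j in simp)
    moreover have "\<not> offset i' n j < offset i n j"
      by (rule once[OF g' g ab(4,5,2,3) l' j2 c(3,4,1,2)]) (use j in simp)
    ultimately show "offset i n j = offset i' n j" by linarith
  qed
qed

text \<open>The block around the origin eventually covers a coordinate at which the points of level \<open>0\<close> differ.\<close>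

lemma good_parsing_eventually_distinct:
  assumes g: "good_parsing x y i"
    and dom: "\<And>n. \<exists>k\<ge>n. i k \<noteq> 0" and codom: "\<And>n. \<exists>k\<ge>n. i k \<noteq> P - 1"
  shows "\<exists>n0. \<forall>n\<ge>n0. x n 0 \<noteq> y n 0"
proof -
  have p: "parsing x i" "parsing y i" using g by (auto simp: good_parsing_def)
  obtain l where l: "x 0 l \<noteq> y 0 l" using g by (auto simp: good_parsing_def fun_eq_iff)
  note dig = parsing_digits[OF p(1)]
  obtain j1 where j1: "\<And>j. j \<ge> j1 \<Longrightarrow> - l \<le> address P i j"
    using address_unbounded[of i P, OF dig dom, of "- l"] by blast
  obtain j2 where j2: "\<And>j. j \<ge> j2 \<Longrightarrow> l + address P i j < P ^ j"
    using address_codominated[of i P, OF dig codom, of l] by blast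
  have "x n 0 \<noteq> y n 0" if "n \<ge> max j1 j2" for n
  proof
    assume "x n 0 = y n 0"
    moreover have "0 \<le> l + offset i 0 n" "l + offset i 0 n < P ^ n"
      using j1[of n] j2[of n] that by simp_all
    ultimately have "x 0 l = y 0 l"
      using parsing_letter[OF p(1), of l 0 n] parsing_letter[OF p(2), of l 0 n] by simp
    then show False using l by contradiction
  qed
  then show ?thesis by blast
qed

text \<open>Besides the letters around the origin, the colour records whether the digits are eventually zero or eventually
  maximal. In these two cases the block at the origin grows in one direction only, and the
  neighbouring letter takes care of the other direction.\<close>

definition colour :: "(nat \<Rightarrow> int \<Rightarrow> 'a) \<times> (nat \<Rightarrow> int \<Rightarrow> 'a) \<times> (nat \<Rightarrow> int) \<Rightarrow> nat
    \<Rightarrow> (bool \<times> bool) \<times> ('a \<times> 'a \<times> 'a) \<times> 'a \<times> 'a \<times> 'a" where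
  "colour = (\<lambda>(x, y, i) n. ((\<exists>n0. \<forall>k\<ge>n0. i k = 0, \<exists>n0. \<forall>k\<ge>n0. i k = P - 1),
     (x n (-1), x n 0, x n 1), y n (-1), y n 0, y n 1))"

text \<open>It suffices to have equal offsets from some level to infinitely many levels of equal colour, by
  \<open>parsing_determined\<close>. Eventually constant digits give this at once; otherwise a pair of distinct letters
  recurs at the origin and \<open>good_parsing_same_offset\<close> applies.\<close>

lemma good_parsing_colour_determines_orbit:
  assumes no: "\<not> double_recurrence"
    and g: "good_parsing x y i" and g': "good_parsing x' y' i'"
    and inf: "infinite {n. colour (x, y, i) n = colour (x', y', i') n}"
  shows "pair_orbit (x 0) (y 0) = pair_orbit (x' 0) (y' 0)"
proof -
  have p: "parsing x i" "parsing y i" "parsing x' i'" "parsing y' i'"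
    using g g' by (auto simp: good_parsing_def)
  define J where "J = {n. \<forall>c\<in>{-1, 0, 1}. x n c = x' n c \<and> y n c = y' n c}"
  have "{n. colour (x, y, i) n = colour (x', y', i') n} \<subseteq> J"
    by (auto simp: colour_def J_def)
  then have J: "infinite J" using inf finite_subset by blast
  obtain n where "colour (x, y, i) n = colour (x', y', i') n"
    using not_finite_existsD[OF inf] by blast
  then have class_eq: "(\<exists>n0. \<forall>k\<ge>n0. i k = 0) = (\<exists>n0. \<forall>k\<ge>n0. i' k = 0)"
      "(\<exists>n0. \<forall>k\<ge>n0. i k = P - 1) = (\<exists>n0. \<forall>k\<ge>n0. i' k = P - 1)"
    by (simp_all add: colour_def)
  have enough: ?thesis if "infinite {j. n + j \<in> J \<and> offset i n j = offset i' n j}" for n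
  proof -
    have "infinite {j. offset i n j = offset i' n j \<and> (\<forall>c\<in>{-1, 0, 1}. x (n + j) c = x' (n + j) c)}"
      using that by (rule contrapos_nn) (rule finite_subset[rotated], assumption, auto simp: J_def)
    then have "x n = x' n" by (rule parsing_determined[OF p(1,3)])
    moreover have "infinite {j. offset i n j = offset i' n j \<and> (\<forall>c\<in>{-1, 0, 1}. y (n + j) c = y' (n + j) c)}"
      using that by (rule contrapos_nn) (rule finite_subset[rotated], assumption, auto simp: J_def)
    then have "y n = y' n" by (rule parsing_determined[OF p(2,4)])
    ultimately show ?thesis by (rule good_parsing_orbit_eq[OF g g'])
  qed
  have shifted: "infinite {j. n + j \<in> K}" if inf_K: "infinite K" for K :: "nat set" and n
    unfolding infinite_nat_iff_unbounded_le
  proof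
    fix m
    obtain k where "k \<ge> n + m" "k \<in> K" using inf_K unfolding infinite_nat_iff_unbounded_le by blast
    then show "\<exists>j\<ge>m. j \<in> {j. n + j \<in> K}" by (intro exI[of _ "k - n"]) auto
  qed
  have cases: "(\<exists>v n0. \<forall>k\<ge>n0. i k = v \<and> i' k = v) \<or>
    (\<forall>n. \<exists>k\<ge>n. i k \<noteq> 0) \<and> (\<forall>n. \<exists>k\<ge>n. i k \<noteq> P - 1) \<and> (\<forall>n. \<exists>k\<ge>n. i' k \<noteq> P - 1)"
  proof -
    have common: "\<exists>n0. \<forall>k\<ge>n0. i k = v \<and> i' k = v"
      if both: "\<exists>n0. \<forall>k\<ge>n0. i k = v" "\<exists>n0. \<forall>k\<ge>n0. i' k = v" for v
    proof -
      obtain n0 n1 where "\<forall>k\<ge>n0. i k = v" "\<forall>k\<ge>n1. i' k = v" using both by blast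
      then show ?thesis by (intro exI[of _ "max n0 n1"]) auto
    qed
    show ?thesis
    proof (cases "(\<exists>n0. \<forall>k\<ge>n0. i k = 0) \<or> (\<exists>n0. \<forall>k\<ge>n0. i k = P - 1)")
      case True
      then have "\<exists>v n0. \<forall>k\<ge>n0. i k = v \<and> i' k = v"
      proof
        assume zero: "\<exists>n0. \<forall>k\<ge>n0. i k = 0"
        show ?thesis by (rule exI, rule common[OF zero class_eq(1)[THEN iffD1, OF zero]])
      next
        assume top: "\<exists>n0. \<forall>k\<ge>n0. i k = P - 1"
        show ?thesis by (rule exI, rule common[OF top class_eq(2)[THEN iffD1, OF top]])
      qed
      then show ?thesis by (rule disjI1)
    next
      case False
      then have "\<not> (\<exists>n0. \<forall>k\<ge>n0. i k = 0)" "\<not> (\<exists>n0. \<forall>k\<ge>n0. i k = P - 1)"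
        "\<not> (\<exists>n0. \<forall>k\<ge>n0. i' k = P - 1)"
        unfolding class_eq(2)[symmetric] by simp_all
      then have "(\<forall>n. \<exists>k\<ge>n. i k \<noteq> 0) \<and> (\<forall>n. \<exists>k\<ge>n. i k \<noteq> P - 1) \<and> (\<forall>n. \<exists>k\<ge>n. i' k \<noteq> P - 1)"
        by (simp only: not_ex not_all not_imp simp_thms)
      then show ?thesis by (rule disjI2)
    qed
  qed
  show ?thesis
  proof (cases "\<exists>v n0. \<forall>k\<ge>n0. i k = v \<and> i' k = v")
    case True
    then obtain v n0 where "\<forall>k\<ge>n0. i k = v \<and> i' k = v" by blast
    then have "(\<lambda>t. i (n0 + t)) = (\<lambda>t. i' (n0 + t))" by simp
    then have "{j. n0 + j \<in> J \<and> offset i n0 j = offset i' n0 j} = {j. n0 + j \<in> J}" by simp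
    then show ?thesis using enough[of n0] shifted[OF J, of n0] by simp
  next
    case False
    then have varying: "\<And>n. \<exists>k\<ge>n. i k \<noteq> 0" "\<And>n. \<exists>k\<ge>n. i k \<noteq> P - 1" "\<And>n. \<exists>k\<ge>n. i' k \<noteq> P - 1"
      using cases by blast+
    have "\<exists>ab\<in>UNIV. infinite {n \<in> J. (x n 0, y n 0) = ab}"
      by (rule pigeonhole_infinite_rel[OF J]) auto
    then obtain a b where "infinite {n \<in> J. (x n 0, y n 0) = (a, b)}" by force
    moreover define J' where "J' = {n \<in> J. x n 0 = a \<and> y n 0 = b}"
    ultimately have J': "infinite J'" by simp
    have J'D: "x n 0 = a" "y n 0 = b" "x' n 0 = a" "y' n 0 = b" "n \<in> J" if "n \<in> J'" for n
      using that by (auto simp: J'_def J_def)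
    obtain n0 where n0: "\<And>n. n \<ge> n0 \<Longrightarrow> x n 0 \<noteq> y n 0"
      using good_parsing_eventually_distinct[OF g varying(1,2)] by blast
    obtain n where n: "n \<ge> n0" "n \<in> J'" using J' unfolding infinite_nat_iff_unbounded_le by blast
    have "a \<noteq> b" using n0[OF n(1)] J'D[OF n(2)] by simp
    obtain j0 where j0: "\<And>j. j \<ge> j0 \<Longrightarrow> x (n + j) 0 = a \<and> y (n + j) 0 = b \<and> x' (n + j) 0 = a \<and> y' (n + j) 0 = b
        \<Longrightarrow> offset i n j = offset i' n j"
      using good_parsing_same_offset[OF no g g' \<open>a \<noteq> b\<close> J'D(1-4)[OF n(2)] varying(2,3)] by blast
    have "infinite {j. n + j \<in> J \<and> offset i n j = offset i' n j}"
      unfolding infinite_nat_iff_unbounded_le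
    proof
      fix m
      obtain j where j: "j \<ge> max m j0" "n + j \<in> J'"
        using shifted[OF J', of n] unfolding infinite_nat_iff_unbounded_le by blast
      then have "offset i n j = offset i' n j" using j0[of j] J'D[OF j(2)] by simp
      then show "\<exists>j\<ge>m. j \<in> {j. n + j \<in> J \<and> offset i n j = offset i' n j}"
        using j J'D(5)[OF j(2)] by (intro exI[of _ j]) simp
    qed
    then show ?thesis by (rule enough)
  qed
qed

lemma li_yorke_orbit_good_parsing:
  assumes comp: "compatible_metric admissible d" and sub: "subshift admissible"
    and orb: "orb \<in> li_yorke_orbits admissible d"
  shows "\<exists>x y i. good_parsing x y i \<and> orb = pair_orbit (x 0) (y 0)"
proof -
  obtain x0 y0 where orb_eq: "orb = pair_orbit x0 y0" and mem: "{x0, y0} \<in> li_yorke_pairs admissible d"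
    using orb by (auto simp: li_yorke_orbits_def)
  from mem obtain u v where uv: "{x0, y0} = {u, v}" "u \<in> admissible" "v \<in> admissible" "li_yorke d u v"
    by (auto simp: li_yorke_pairs_def)
  have u: "\<exists>l. u l \<noteq> v l" "proximal_right u v"
    using uv li_yorke_iff[OF comp sub uv(2,3)] unfolding proximal_right_def by blast+
  have xy: "x0 \<in> admissible" "y0 \<in> admissible" "x0 \<noteq> y0" "proximal_right x0 y0"
    using uv(1-3) u unfolding doubleton_eq_iff proximal_right_def by (auto simp: eq_commute)
  obtain x y i where p: "x 0 = x0" "y 0 = y0" "parsing x i" "parsing y i" "\<And>n. proximal_right (x n) (y n)"
    using proximal_common_parsing[OF xy(1,2,4)] by blast
  have "\<exists>l>0. x n l = y n l" for n
  proof -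
    obtain s where "s \<ge> 0" "\<And>l. s \<le> l \<and> l \<le> s + 1 \<Longrightarrow> x n l = y n l"
      using p(5)[of n] unfolding proximal_right_def by blast
    then show ?thesis by (intro exI[of _ "s + 1"]) simp
  qed
  then show ?thesis using p xy(3) orb_eq unfolding good_parsing_def by blast
qed

lemma finite_li_yorke_orbits:
  assumes no: "\<not> double_recurrence"
    and comp: "compatible_metric admissible d" and sub: "subshift admissible"
  shows "finite (li_yorke_orbits admissible d)"
proof -
  have "\<forall>orb\<in>li_yorke_orbits admissible d. \<exists>u. case u of (x, y, i) \<Rightarrow> good_parsing x y i \<and> orb = pair_orbit (x 0) (y 0)"
    using li_yorke_orbit_good_parsing[OF comp sub] by fastforce
  then obtain f where f: "\<forall>orb\<in>li_yorke_orbits admissible d.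
      case f orb of (x, y, i) \<Rightarrow> good_parsing x y i \<and> orb = pair_orbit (x 0) (y 0)"
    by (rule bchoice[THEN exE])
  show ?thesis
  proof (rule finite_if_colourings_separate[where c = "\<lambda>orb. colour (f orb)"])
    fix orb orb' assume mem: "orb \<in> li_yorke_orbits admissible d" "orb' \<in> li_yorke_orbits admissible d"
      and inf: "infinite {n. colour (f orb) n = colour (f orb') n}"
    obtain x y i where forb: "f orb = (x, y, i)" by (cases "f orb")
    obtain x' y' i' where forb': "f orb' = (x', y', i')" by (cases "f orb'")
    have g: "good_parsing x y i" "orb = pair_orbit (x 0) (y 0)"
      using bspec[OF f mem(1)] unfolding forb prod.case by (rule conjunct1, rule conjunct2)
    have g': "good_parsing x' y' i'" "orb' = pair_orbit (x' 0) (y' 0)"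
      using bspec[OF f mem(2)] unfolding forb' prod.case by (rule conjunct1, rule conjunct2)
    show "orb = orb'"
      unfolding g(2) g'(2)
      by (rule good_parsing_colour_determines_orbit[OF no g(1) g'(1) inf[unfolded forb forb']])
  qed
qed

end

section \<open>Words and positions\<close>

context primitive_subst_constant_length
begin

lemma double_recurrence_iff_words:
  "double_recurrence \<longleftrightarrow> (\<exists>m a b u v w u' v' w'.
      a \<noteq> b \<and>
      subst_pow \<tau> m a = u @ [a] @ v @ [a] @ w \<and>
      subst_pow \<tau> m b = u' @ [b] @ v' @ [b] @ w' \<and>
      length u = length u' \<and> length v = length v' \<and> length w = length w' \<and>
      has_coincidence (v @ [a] @ w) (v' @ [b] @ w'))"
    (is "_ \<longleftrightarrow> ?W")
proof
  assume double_recurrence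
  then obtain m a b and s t r :: int where *: "a \<noteq> b" "0 \<le> s" "s < t" "t < P ^ m" "s < r" "r < P ^ m"
    "blk m a s = a" "blk m a t = a" "blk m b s = b" "blk m b t = b" "blk m a r = blk m b r"
    unfolding double_recurrence_def by blast
  define S where "S = nat s"
  define T where "T = nat t"
  define R where "R = nat r"
  have lt: "S < T" "T < p ^ m" "S < R" "R < p ^ m"
    using * by (auto simp: S_def T_def R_def nat_less_iff)
  define v where "v W = take (T - Suc S) (drop (Suc S) W)" for W :: "'a list"
  have split: "subst_pow \<tau> m c = take S (subst_pow \<tau> m c) @ [c] @ v (subst_pow \<tau> m c) @ [c] @ drop (Suc T) (subst_pow \<tau> m c)"
    "drop (Suc S) (subst_pow \<tau> m c) = v (subst_pow \<tau> m c) @ [c] @ drop (Suc T) (subst_pow \<tau> m c)"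
    if "blk m c s = c" "blk m c t = c" for c
  proof -
    let ?W = "subst_pow \<tau> m c"
    have len: "length ?W = p ^ m" by (rule length_subst_pow)
    have W: "?W ! S = c" "?W ! T = c" using that by (auto simp: blk_def S_def T_def)
    have "drop (Suc S) ?W = take (T - Suc S) (drop (Suc S) ?W) @ drop (Suc S) ?W ! (T - Suc S) # drop (Suc (T - Suc S)) (drop (Suc S) ?W)"
      using lt len by (intro id_take_nth_drop) simp
    then show 2: "drop (Suc S) ?W = v ?W @ [c] @ drop (Suc T) ?W"
      using lt len W by (simp add: v_def)
    have "?W = take S ?W @ ?W ! S # drop (Suc S) ?W" using lt len by (intro id_take_nth_drop) simp
    then show "?W = take S ?W @ [c] @ v ?W @ [c] @ drop (Suc T) ?W" using 2 W by simp
  qed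
  let ?A = "subst_pow \<tau> m a" and ?B = "subst_pow \<tau> m b"
  have "has_coincidence (drop (Suc S) ?A) (drop (Suc S) ?B)"
    unfolding has_coincidence_def
  proof (intro conjI exI[of _ "R - Suc S"])
    show "drop (Suc S) ?A ! (R - Suc S) = drop (Suc S) ?B ! (R - Suc S)"
      using *(11) lt by (simp add: length_subst_pow blk_def R_def)
  qed (use lt in \<open>auto simp: length_subst_pow\<close>)
  moreover note sa = split[OF *(7,8)] and sb = split[OF *(9,10)]
  ultimately have co: "has_coincidence (v ?A @ [a] @ drop (Suc T) ?A) (v ?B @ [b] @ drop (Suc T) ?B)"
    by simp
  show ?W
    by (intro exI conjI, rule *(1), rule sa(1), rule sb(1)) (use co in \<open>auto simp: v_def length_subst_pow\<close>)
next
  assume ?W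
  then obtain m a b u v w u' v' w' where *: "a \<noteq> b"
      "subst_pow \<tau> m a = u @ [a] @ v @ [a] @ w" "subst_pow \<tau> m b = u' @ [b] @ v' @ [b] @ w'"
      "length u = length u'" "length v = length v'" "length w = length w'"
      "has_coincidence (v @ [a] @ w) (v' @ [b] @ w')" by blast
  obtain k where k: "k < length (v @ [a] @ w)" "(v @ [a] @ w) ! k = (v' @ [b] @ w') ! k"
    using *(7) unfolding has_coincidence_def by blast
  define s t r where "s = length u" "t = length u + 1 + length v" "r = length u + 1 + k"
  note str = this
  have "length u + 1 + length v + 1 + length w = p ^ m"
    using length_subst_pow[of m a] unfolding *(2) by simp
  then have lt: "s < t" "t < p ^ m" "s < r" "r < p ^ m" using k(1) by (auto simp: str)
  have A: "subst_pow \<tau> m a ! s = a" "subst_pow \<tau> m a ! t = a" "subst_pow \<tau> m a ! r = (v @ [a] @ w) ! k"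
    unfolding *(2) by (auto simp: str nth_append)
  have B: "subst_pow \<tau> m b ! s = b" "subst_pow \<tau> m b ! t = b" "subst_pow \<tau> m b ! r = (v' @ [b] @ w') ! k"
    unfolding *(3) by (auto simp: str nth_append *(4,5))
  show double_recurrence
    unfolding double_recurrence_def
    using lt A B k(2) *(1)
    by (intro exI[of _ m] exI[of _ a] exI[of _ b] exI[of _ "int s"] exI[of _ "int t"] exI[of _ "int r"])
       (auto simp: blk_def simp flip: of_nat_power)
qed

end

lemma countable_li_yorke_pairs_if_orbits:
  assumes "countable (li_yorke_orbits X d)"
  shows "countable (li_yorke_pairs X d)"
proof (rule countable_subset)
  show "li_yorke_pairs X d \<subseteq> (\<Union>orb\<in>li_yorke_orbits X d. (\<lambda>q. {fst q, snd q}) ` orb)"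
  proof
    fix q assume q: "q \<in> li_yorke_pairs X d"
    then obtain x y where xy: "q = {x, y}" by (auto simp: li_yorke_pairs_def)
    have "(x, y) \<in> pair_orbit x y" unfolding pair_orbit_def by (auto intro: exI[of _ 0])
    then have "q \<in> (\<lambda>q. {fst q, snd q}) ` pair_orbit x y" unfolding xy by force
    moreover have "pair_orbit x y \<in> li_yorke_orbits X d" using q xy by (auto simp: li_yorke_orbits_def)
    ultimately show "q \<in> (\<Union>orb\<in>li_yorke_orbits X d. (\<lambda>q. {fst q, snd q}) ` orb)" by blast
  qed
  have "countable orb" if orb: "orb \<in> li_yorke_orbits X d" for orb
  proof -
    obtain x y where "orb = pair_orbit x y" using orb by (auto simp: li_yorke_orbits_def)
    then have "orb = range (\<lambda>n. (shift_iter n x, shift_iter n y))" by (auto simp: pair_orbit_def)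
    then show ?thesis by simp
  qed
  then show "countable (\<Union>orb\<in>li_yorke_orbits X d. (\<lambda>q. {fst q, snd q}) ` orb)"
    using assms by blast
qed

theorem proposition3p8:
  fixes \<tau> :: "'a::finite \<Rightarrow> 'a list"
    and p :: nat
    and d :: "(int \<Rightarrow> 'a) \<Rightarrow> (int \<Rightarrow> 'a) \<Rightarrow> real"
  assumes "substitution \<tau>"
    and "inj \<tau>"
    and "primitive_subst \<tau>"
    and "constant_length \<tau> p"
    and "p \<ge> 2"
    and "infinite (subst_shift \<tau>)"
    and "compatible_metric (subst_shift \<tau>) d"
  shows "(finite (li_yorke_orbits (subst_shift \<tau>) d) \<or>
          uncountable (li_yorke_orbits (subst_shift \<tau>) d)) \<and>
         (uncountable (li_yorke_pairs (subst_shift \<tau>) d) \<longleftrightarrow>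
           (\<exists>m a b u v w u' v' w'.
              a \<noteq> b \<and>
              subst_pow \<tau> m a = u @ [a] @ v @ [a] @ w \<and>
              subst_pow \<tau> m b = u' @ [b] @ v' @ [b] @ w' \<and>
              length u = length u' \<and> length v = length v' \<and> length w = length w' \<and>
              has_coincidence (v @ [a] @ w) (v' @ [b] @ w')))"
proof -
  interpret primitive_subst_constant_length \<tau> p
    using assms by unfold_locales auto
  have X: "subst_shift \<tau> = admissible" by (rule subst_shift_eq_admissible)
  interpret aperiodic_subst \<tau> p
    using assms X by unfold_locales auto
  have comp: "compatible_metric admissible d" using assms(7) X by simp
  have sub: "subshift admissible" by (rule subshift_admissible)
  have unc: "uncountable (li_yorke_pairs admissible d)" if rec: double_recurrence
  proof -
    obtain m a b s t r where "a \<noteq> b" "0 \<le> s" "s < t" "t < P ^ m" "s < r" "r < P ^ m"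
      "blk m a s = a" "blk m a t = a" "blk m b s = b" "blk m b t = b" "blk m a r = blk m b r"
      using rec unfolding double_recurrence_def by blast
    then show ?thesis by (rule uncountable_li_yorke_pairs[OF infinite comp sub])
  qed
  have fin: "finite (li_yorke_orbits admissible d)" if "\<not> double_recurrence"
    by (rule finite_li_yorke_orbits[OF that comp sub])
  have dichotomy: "(finite (li_yorke_orbits admissible d) \<or> uncountable (li_yorke_orbits admissible d)) \<and>
      (uncountable (li_yorke_pairs admissible d) \<longleftrightarrow> double_recurrence)"
  proof (cases double_recurrence)
    case True
    then show ?thesis using unc[OF True] countable_li_yorke_pairs_if_orbits[of admissible d] by auto
  next
    case False
    have "countable (li_yorke_pairs admissible d)"
      by (rule countable_li_yorke_pairs_if_orbits[OF countable_finite[OF fin[OF False]]])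
    then show ?thesis using fin[OF False] False by simp
  qed
  show ?thesis
    using dichotomy unfolding X double_recurrence_iff_words .
qed

end
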